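(* Let $A$ be an unbounded nonnegative discrete multiplication operator on a Hilbert space $\mathcal{H}$, with eigenbasis $\{e_i\}$ and eigenvalues $\lambda_i^2$. Let $\mu_1,\mu_2,\alpha,H$ be real numbers with $0<\mu_1<\mu_2$, $\alpha\in(0,1)$, $H>0$. Let $\delta,\sigma,s,S,r_0$ be real numbers with $$\delta\ge 0,\qquad \sigma\ge 0,\qquad 2\sigma<1-\alpha,\qquad s=S=\frac{1}{1-\alpha},\qquad r_0>0,$$ and set $$t_0:=\frac{32\,\mu_2^{(1+\alpha)/2}}{H}\,r_0 .$$ Then the set of propagation speeds $c\in\mathcal{PS}(\mu_1,\mu_2,\alpha,H)$ for which the equation $u''+2\delta A^{\sigma}u'+c(t)Au=0$ admits a very weak solution $u$ satisfying $$(u(0),u'(0))\in\mathcal{G}_{s,r_0,1/2}(A)\times\mathcal{G}_{s,r_0,0}(A)$$ and $$(u(t),u'(t))\notin\mathcal{G}_{-S,\log,1/2}(A)\times\mathcal{G}_{-S,\log,0}(A)\qquad\forall t>t_0$$ is residual in $\mathcal{PS}(\mu_1,\mu_2,\alpha,H)$ with respect to the distance induced by the uniform ($L^\infty$) norm.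
   Context: A nonnegative discrete multiplication operator $A$ on a Hilbert space $\mathcal{H}$ is given by an orthonormal basis $\{e_i\}_{i\in\mathbb{N}}$ and a nondecreasing sequence $\{\lambda_i\}$ of nonnegative reals with $Ae_i=\lambda_i^2e_i$; it is unbounded if $\lambda_i\to+\infty$. Elements are identified with coefficient sequences $u=\{u_i\}$ (with respect to $\{e_i\}$), and the following spaces of sequences are used ($\beta\in\mathbb{R}$, $s,S,r>0$): - $u\in\mathcal{G}_{s,r,\beta}(A)$ iff $\sum_i u_i^2(1+\lambda_i)^{4\beta}\exp(2r\lambda_i^{1/s})<+\infty$; - $u\in\mathcal{G}_{-S,\log,\beta}(A)$ iff $\sum_i u_i^2(1+\lambda_i)^{4\beta}\exp\!\big(-2\lambda_i^{1/S}/\log(2+\lambda_i)\big)<+\infty$. For $0<\mu_1<\mu_2$, $\alpha\in(0,1)$, $H>0$, $\mathcal{PS}(\mu_1,\mu_2,\alpha,H)$ is the set of functions $c:[0,+\infty)\to[0,+\infty)$ with $\mu_1\le c(t)\le\mu_2$ for all $t\ge0$ and $|c(t)-c(s)|\le H|t-s|^\alpha$ for all $t,s\ge 0$; it is a complete metric space with the uniform distance. A subset of a complete metric space is residual if it contains a countable intersection of open dense sets. A very weak solution of $u''+2\delta A^\sigma u'+c(t)Au=0$ is a sequence $\{u_i(t)\}$ of $C^2$ functions on $[0,+\infty)$ with $u_i''(t)+2\delta\lambda_i^{2\sigma}u_i'(t)+c(t)\lambda_i^2u_i(t)=0$ for every $i$ and $t\ge 0$; one writes $u(t)=\{u_i(t)\}$,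 $u'(t)=\{u_i'(t)\}$. *)

theory Defs
  imports "HOL-Analysis.Analysis"
begin

text \<open>Discrete multiplication operator: given by the sequence lam (A e_i = lam_i^2 e_i).
Elements are identified with coefficient sequences nat => real.\<close>

definition unbounded_discrete_mult_op :: "(nat \<Rightarrow> real) \<Rightarrow> bool" where
  "unbounded_discrete_mult_op lam \<longleftrightarrow>
     (\<forall>i. 0 \<le> lam i) \<and> mono lam \<and> filterlim lam at_top sequentially"

text \<open>Eigenvalue of A^sigma on e_i, i.e. (lam_i^2)^sigma, with the convention 0^0 = 1.\<close>
definition Apow_eig :: "(nat \<Rightarrow> real) \<Rightarrow> real \<Rightarrow> nat \<Rightarrow> real" where
  "Apow_eig lam \<sigma> i = (if \<sigma> = 0 then 1 else lam i powr (2 * \<sigma>))"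

definition gevrey_space :: "(nat \<Rightarrow> real) \<Rightarrow> real \<Rightarrow> real \<Rightarrow> real \<Rightarrow> (nat \<Rightarrow> real) set" where
  "gevrey_space lam s r \<beta> =
     {u. summable (\<lambda>i. (u i)\<^sup>2 * (1 + lam i) powr (4 * \<beta>) * exp (2 * r * lam i powr (1 / s)))}"

definition ultradist_log_space :: "(nat \<Rightarrow> real) \<Rightarrow> real \<Rightarrow> real \<Rightarrow> (nat \<Rightarrow> real) set" where
  "ultradist_log_space lam S \<beta> =
     {u. summable (\<lambda>i. (u i)\<^sup>2 * (1 + lam i) powr (4 * \<beta>)
                        * exp (- (2 * lam i powr (1 / S)) / ln (2 + lam i)))}"

text \<open>Propagation speeds; functions on [0,+oo) are represented as functions real => real
that vanish on the negative reals (a normalisation making the representation unique).\<close>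
definition PS :: "real \<Rightarrow> real \<Rightarrow> real \<Rightarrow> real \<Rightarrow> (real \<Rightarrow> real) set" where
  "PS \<mu>1 \<mu>2 \<alpha> H =
     {c. (\<forall>t\<ge>0. \<mu>1 \<le> c t \<and> c t \<le> \<mu>2)
       \<and> (\<forall>t\<ge>0. \<forall>s\<ge>0. \<bar>c t - c s\<bar> \<le> H * \<bar>t - s\<bar> powr \<alpha>)
       \<and> (\<forall>t<0. c t = 0)}"

definition udist :: "(real \<Rightarrow> real) \<Rightarrow> (real \<Rightarrow> real) \<Rightarrow> real" where
  "udist c d = (SUP t\<in>{0..}. \<bar>c t - d t\<bar>)"

definition open_in_space :: "(real \<Rightarrow> real) set \<Rightarrow> (real \<Rightarrow> real) set \<Rightarrow> bool" where
  "open_in_space X U \<longleftrightarrow> U \<subseteq> X \<and> (\<forall>c\<in>U. \<exists>\<epsilon>>0. \<forall>d\<in>X. udist c d < \<epsilon> \<longrightarrow> d \<in> U)"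

definition dense_in_space :: "(real \<Rightarrow> real) set \<Rightarrow> (real \<Rightarrow> real) set \<Rightarrow> bool" where
  "dense_in_space X U \<longleftrightarrow> U \<subseteq> X \<and> (\<forall>c\<in>X. \<forall>\<epsilon>>0. \<exists>d\<in>U. udist c d < \<epsilon>)"

definition residual_in_space :: "(real \<Rightarrow> real) set \<Rightarrow> (real \<Rightarrow> real) set \<Rightarrow> bool" where
  "residual_in_space X R \<longleftrightarrow> R \<subseteq> X \<and>
     (\<exists>U :: nat \<Rightarrow> (real \<Rightarrow> real) set.
        (\<forall>n. open_in_space X (U n) \<and> dense_in_space X (U n)) \<and> X \<inter> (\<Inter>n. U n) \<subseteq> R)"

definition very_weak_solution ::
  "(nat \<Rightarrow> real) \<Rightarrow> real \<Rightarrow> real \<Rightarrow> (real \<Rightarrow> real) \<Rightarrow> (nat \<Rightarrow> real \<Rightarrow> real) \<Rightarrow> (nat \<Rightarrow> real \<Rightarrow> real) \<Rightarrow> bool" where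
  "very_weak_solution lam \<delta> \<sigma> c u v \<longleftrightarrow>
     (\<forall>i. \<exists>w. continuous_on {0..} w \<and>
        (\<forall>t\<ge>0. (u i has_real_derivative v i t) (at t within {0..})
              \<and> (v i has_real_derivative w t) (at t within {0..})
              \<and> w t + 2 * \<delta> * Apow_eig lam \<sigma> i * v i t + c t * (lam i)\<^sup>2 * u i t = 0))"

end

theory Submission
  imports Defs
begin

text \<open>
  By a Baire argument it suffices that a generic speed carries, for every n, one mode i \<ge> n that
  starts with size at most 2^(-n) exp(-r0 lam_i^(1-\<alpha>)) and exceeds exp(lam_i^(1-\<alpha>)/log(2+lam_i))
  throughout [t0 + 1/(n+1), n+1]: superposing such modes gives the required solution. These sets of
  speeds are open since modes depend continuously on c. For density, c is first contracted and
  averaged to a C^2 function \<gamma>, and then the speed is read off from the prescribed oscillation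
  u = sin \<phi> exp \<psi> with \<phi>' = lam \<surd>\<gamma> and \<psi>' = k sin^2 \<phi> - \<gamma>'/(4\<gamma>) - b, where b is the damping
  coefficient. This choice of \<psi>' makes u'' + 2bu' divisible by sin \<phi>. The speed so obtained is
  \<gamma> - (2k\<surd>\<gamma>/lam) sin 2\<phi> up to smaller terms; with
  k = \<kappa> lam^(1-\<alpha>) the oscillation has Hoelder constant at most 4\<kappa> \<mu>2^((1+\<alpha>)/2), and u grows like
  exp(\<kappa> lam^(1-\<alpha>) t / 2). Taking \<kappa> = H / (16 \<mu>2^((1+\<alpha>)/2)) gives the rate r0/t0.
\<close>

section \<open>Single modes\<close>

text \<open>The obstacle is that the resonant speed must stay in a class with a fixed Hoelder
  constant, while growth at rate \<open>lam^(1-\<alpha>)\<close> needs an oscillation of amplitude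
  about \<open>lam^(-\<alpha>)\<close> at frequency about \<open>lam\<close>, whose Hoelder constant
  stays of order one. Contraction therefore creates room strictly below \<open>H\<close>, and
  smoothing makes the background nearly constant on the scale of the oscillation. The oscillation is
  tuned to have Hoelder constant tending to at most \<open>H/4\<close>, safely below the
  \<open>H/2\<close> that this room can absorb. At time \<open>t0\<close> growth exactly compensates
  the initial smallness. Each time window opens \<open>1/(n+1)\<close> later, and this delay yields
  an extra exponent proportional to \<open>lam^(1-\<alpha>)\<close>. For large \<open>lam\<close> it
  dominates the damping \<open>lam^(2\<sigma>)\<close>, all fixed factors, and the demanded
  \<open>lam^(1-\<alpha>)/log(2+lam)\<close>; the logarithm is what lets an arbitrarily small delay
  suffice. Windows are bounded because the estimate for the dependence of a mode on the speed
  deteriorates exponentially in time.\<close>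

lemma antiderivative_exists:
  fixes f :: "real \<Rightarrow> real"
  assumes "continuous_on UNIV f"
  shows "\<exists>F. F 0 = 0 \<and> (\<forall>t. (F has_real_derivative f t) (at t))"
proof -
  have "\<exists>F. \<forall>x::real. -\<infinity> < ereal x \<longrightarrow> ereal x < \<infinity> \<longrightarrow> (F has_vector_derivative f x) (at x)"
    by (rule einterval_antiderivative) (use assms in \<open>auto simp: continuous_on_eq_continuous_at\<close>)
  then obtain F where F: "\<And>x. (F has_real_derivative f x) (at x)"
    by (auto simp: has_real_derivative_iff_has_vector_derivative)
  have "((\<lambda>x. F x - F 0) has_real_derivative f t) (at t)" for t
    using DERIV_diff[OF F DERIV_const[of "F 0"]] by simp
  then show ?thesis by (intro exI[of _ "\<lambda>x. F x - F 0"]) auto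
qed

text \<open>Both \<open>B / K * exp (K * x) + f x\<close> and
  \<open>B / K * exp (K * x) - f x\<close> are nondecreasing. Measured against
  \<open>exp (K * t)\<close>, each integration gains a factor \<open>1 / K\<close>, so a large
  \<open>K\<close> makes the Picard series converge geometrically on the whole half-line.\<close>

lemma abs_le_exp_if_deriv_le_exp:
  fixes f :: "real \<Rightarrow> real"
  assumes "f 0 = 0" and f': "\<And>x. (f has_real_derivative f' x) (at x)"
    and bd: "\<And>x. 0 \<le> x \<Longrightarrow> \<bar>f' x\<bar> \<le> B * exp (K * x)" and "0 < K" "0 \<le> t"
  shows "\<bar>f t\<bar> \<le> B / K * exp (K * t)"
proof -
  have B: "0 \<le> B" using bd[of 0] by auto
  have "B / K * exp (K * 0) + s * f 0 \<le> B / K * exp (K * t) + s * f t" if "s = 1 \<or> s = -1" for s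
  proof (rule DERIV_nonneg_imp_nondecreasing[OF \<open>0 \<le> t\<close>])
    fix x assume x: "0 \<le> x" "x \<le> t"
    have "((\<lambda>x. B / K * exp (K * x) + s * f x) has_real_derivative
        B * exp (K * x) + s * f' x) (at x)"
      using \<open>0 < K\<close> by (auto intro!: derivative_eq_intros f')
    moreover have "0 \<le> B * exp (K * x) + s * f' x"
      using bd[OF x(1)] that by auto
    ultimately show "\<exists>y. ((\<lambda>x. B / K * exp (K * x) + s * f x) has_real_derivative y) (at x) \<and> 0 \<le> y"
      by blast
  qed
  from this[of 1] this[of "-1"] show ?thesis
    using assms(1) B \<open>0 < K\<close> by (simp add: abs_le_iff) (smt (verit) divide_nonneg_pos)
qed

text \<open>Termwise differentiation by the Weierstrass test. The weight \<open>exp (K * x)\<close>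
  is unbounded on the half-line, so the test is run on \<open>{0..t + 1}\<close>; its right end lies
  beyond \<open>t\<close>, hence derivatives at \<open>t\<close> within this interval and within
  \<open>{0..}\<close> coincide.\<close>

lemma series_has_derivative_atLeast:
  fixes f f' :: "nat \<Rightarrow> real \<Rightarrow> real"
  assumes f': "\<And>n x. (f n has_real_derivative f' n x) (at x)"
    and bf: "\<And>n x. 0 \<le> x \<Longrightarrow> \<bar>f n x\<bar> \<le> C * (1/2) ^ n * exp (K * x)"
    and bf': "\<And>n x. 0 \<le> x \<Longrightarrow> \<bar>f' n x\<bar> \<le> C * (1/2) ^ n * exp (K * x)"
    and "0 < K" "0 \<le> t"
  shows "((\<lambda>x. \<Sum>n. f n x) has_real_derivative (\<Sum>n. f' n t)) (at t within {0..})"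
proof -
  define S where "S = {0..t + 1}"
  have C: "0 \<le> C" using bf[of 0 0] by auto
  have lim: "uniform_limit S (\<lambda>n x. \<Sum>i<n. f' i x) (\<lambda>x. \<Sum>i. f' i x) sequentially"
  proof (rule Weierstrass_m_test)
    fix n x assume "x \<in> S"
    then have x: "0 \<le> x" "x \<le> t + 1" by (auto simp: S_def)
    have "\<bar>f' n x\<bar> \<le> C * (1/2) ^ n * exp (K * x)" by (rule bf'[OF x(1)])
    also have "\<dots> \<le> C * (1/2) ^ n * exp (K * (t + 1))"
      using x C \<open>0 < K\<close> by (intro mult_left_mono) auto
    finally show "norm (f' n x) \<le> C * exp (K * (t + 1)) * (1/2) ^ n" by (simp add: mult_ac)
  next
    show "summable (\<lambda>n. C * exp (K * (t + 1)) * (1/2) ^ n)"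
      by (intro summable_mult summable_geometric) auto
  qed
  have "\<exists>g. \<forall>x\<in>S. (\<lambda>n. f n x) sums g x \<and>
      (g has_field_derivative (\<Sum>i. f' i x)) (at x within S)"
  proof (rule has_field_derivative_series[OF _ _ lim])
    show "convex S" by (simp add: S_def)
    show "0 \<in> S" using \<open>0 \<le> t\<close> by (simp add: S_def)
    show "summable (\<lambda>n. f n 0)"
      by (rule summable_comparison_test'[where g = "\<lambda>n. C * (1/2) ^ n" and N = 0])
        (use bf[of 0] in \<open>auto intro!: summable_mult summable_geometric\<close>)
  qed (auto intro: has_field_derivative_at_within f')
  then obtain g where g: "\<And>x. x \<in> S \<Longrightarrow> (\<lambda>n. f n x) sums g x"
    and g': "\<And>x. x \<in> S \<Longrightarrow> (g has_field_derivative (\<Sum>i. f' i x)) (at x within S)" by blast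
  have tS: "t \<in> S" using \<open>0 \<le> t\<close> by (simp add: S_def)
  have "((\<lambda>x. \<Sum>n. f n x) has_real_derivative (\<Sum>n. f' n t)) (at t within S)"
    by (rule has_field_derivative_transform_within[OF g'[OF tS], of 1])
      (use tS g sums_unique in auto)
  moreover have "at t within S = at t within {0..}"
    by (rule at_within_nhd[of _ "{..<t+1}"]) (auto simp: S_def)
  ultimately show ?thesis by simp
qed

lemma second_order_ode_exists:
  fixes q :: "real \<Rightarrow> real"
  assumes q: "continuous_on UNIV q" and qQ: "\<And>t. \<bar>q t\<bar> \<le> Q"
  shows "\<exists>w w'. w 0 = x0 \<and> w' 0 = y0 \<and>
    (\<forall>t\<ge>0. (w has_real_derivative w' t) (at t within {0..}) \<and>
      (w' has_real_derivative q t * w t) (at t within {0..}))"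
proof -
  have "\<exists>I. \<forall>f :: real \<Rightarrow> real. continuous_on UNIV f \<longrightarrow> I f 0 = 0 \<and>
      (\<forall>t. (I f has_real_derivative f t) (at t))"
    using antiderivative_exists by (intro choice) blast
  then obtain I :: "(real \<Rightarrow> real) \<Rightarrow> real \<Rightarrow> real" where
    I0: "\<And>f. continuous_on UNIV f \<Longrightarrow> I f 0 = 0" and
    I': "\<And>f t. continuous_on UNIV f \<Longrightarrow> (I f has_real_derivative f t) (at t)"
    by blast
  have Ic: "continuous_on UNIV (I f)" if "continuous_on UNIV f" for f
    using I'[OF that] by (intro DERIV_continuous_on) (auto intro: has_field_derivative_at_within)
  \<comment> \<open>The \<open>W n\<close> are the increments of the Picard iterates, and the
    solution is their sum; \<open>V n\<close> and \<open>Z n\<close> are their first and second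
    derivatives. \<open>Z 0\<close> vanishes because \<open>W 0\<close> is affine, and summing
    \<open>Z (Suc n) t = q t * W n t\<close> gives the equation.\<close>
  define W where "W = rec_nat (\<lambda>t. x0 + y0 * t) (\<lambda>n f. I (I (\<lambda>t. q t * f t)))"
  define V where "V n = (case n of 0 \<Rightarrow> (\<lambda>_. y0) | Suc m \<Rightarrow> I (\<lambda>t. q t * W m t))" for n
  define Z where "Z n = (case n of 0 \<Rightarrow> (\<lambda>_. 0) | Suc m \<Rightarrow> (\<lambda>t. q t * W m t))" for n
  have W0: "W 0 = (\<lambda>t. x0 + y0 * t)" and WS: "W (Suc n) = I (V (Suc n))" for n
    by (auto simp: W_def V_def)
  have Wc: "continuous_on UNIV (W n)" for n
    by (induction n) (auto simp: W_def intro!: continuous_intros Ic q)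
  have Zc: "continuous_on UNIV (Z n)" for n
    by (cases n) (auto simp: Z_def intro!: continuous_intros q Wc)
  have VS: "V (Suc n) = I (Z (Suc n))" for n by (simp add: V_def Z_def)
  have V': "(V n has_real_derivative Z n t) (at t)" for n t
    by (cases n) (auto simp: VS intro!: I' Zc, simp add: V_def Z_def)
  have Vc: "continuous_on UNIV (V n)" for n
    by (cases n) (auto simp: VS intro!: Ic Zc, simp add: V_def)
  have W': "(W n has_real_derivative V n t) (at t)" for n t
    by (cases n) (auto simp: WS intro!: I' Vc, auto simp: W0 V_def intro!: derivative_eq_intros)
  \<comment> \<open>\<open>2 * Q \<le> K\<close> gives the ratio 1/2 when \<open>q * W n\<close> is
    integrated once; \<open>1 \<le> K\<close> makes the second integration harmless and bounds
    \<open>1 + x\<close> by \<open>exp (K * x)\<close>.\<close>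
  define K where "K = 2 + 2 * Q"
  define C where "C = \<bar>x0\<bar> + \<bar>y0\<bar>"
  have Q: "0 \<le> Q" using qQ[of 0] by auto
  have K: "0 < K" "2 \<le> K" "2 * Q \<le> K" using Q by (auto simp: K_def)
  have bd: "\<bar>W n x\<bar> \<le> C * (1/2) ^ n * exp (K * x) \<and> \<bar>V n x\<bar> \<le> C * (1/2) ^ n * exp (K * x)
      \<and> \<bar>Z n x\<bar> \<le> K * C * (1/2) ^ n * exp (K * x)" if "0 \<le> x" for n x
    using that
  proof (induction n arbitrary: x)
    case 0
    have "1 + x \<le> exp x" by simp
    also have "\<dots> \<le> exp (K * x)" using 0 K mult_right_mono[of 1 K x] by auto
    finally have e: "1 + x \<le> exp (K * x)" .
    have "\<bar>x0 + y0 * x\<bar> \<le> \<bar>x0\<bar> + \<bar>y0\<bar> * x"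
      using 0 by (metis abs_mult abs_of_nonneg abs_triangle_ineq)
    also have "\<dots> \<le> C * (1 + x)" using 0 by (simp add: C_def algebra_simps)
    also have "\<dots> \<le> C * exp (K * x)" using e by (intro mult_left_mono) (auto simp: C_def)
    finally have 1: "\<bar>x0 + y0 * x\<bar> \<le> C * exp (K * x)" .
    have "\<bar>y0\<bar> \<le> C * 1" by (simp add: C_def)
    also have "\<dots> \<le> C * exp (K * x)" using e 0 by (intro mult_left_mono) (auto simp: C_def simp del: one_le_exp_iff)
    finally show ?case using 1 K by (simp add: W0 V_def Z_def C_def)
  next
    case (Suc n)
    have Z: "\<bar>Z (Suc n) y\<bar> \<le> Q * C * (1/2) ^ n * exp (K * y)" if "0 \<le> y" for y
    proof -
      have "\<bar>Z (Suc n) y\<bar> = \<bar>q y\<bar> * \<bar>W n y\<bar>" by (simp add: Z_def abs_mult)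
      also have "\<dots> \<le> Q * (C * (1/2) ^ n * exp (K * y))"
        using Suc.IH[OF that] qQ Q by (intro mult_mono) auto
      finally show ?thesis by (simp add: mult_ac)
    qed
    have C0: "0 \<le> C * (1/2) ^ n" by (simp add: C_def)
    have V: "\<bar>V (Suc n) y\<bar> \<le> C * (1/2) ^ (Suc n) * exp (K * y)" if "0 \<le> y" for y
    proof -
      have "\<bar>V (Suc n) y\<bar> \<le> Q * C * (1/2) ^ n / K * exp (K * y)"
        by (rule abs_le_exp_if_deriv_le_exp[OF _ V' Z K(1) that]) (auto simp: VS intro!: I0 Zc)
      also have "Q * C * (1/2) ^ n / K = (Q / K) * (C * (1/2) ^ n)" by simp
      also have "\<dots> * exp (K * y) \<le> (1/2) * (C * (1/2) ^ n) * exp (K * y)"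
        using K C0 by (intro mult_right_mono) (auto simp: field_simps)
      finally show ?thesis by simp
    qed
    have "\<bar>W (Suc n) x\<bar> \<le> C * (1/2) ^ (Suc n) / K * exp (K * x)"
      by (rule abs_le_exp_if_deriv_le_exp[OF _ W' V K(1) Suc.prems]) (auto simp: WS intro!: I0 Vc)
    also have "\<dots> \<le> C * (1/2) ^ (Suc n) * exp (K * x)"
      using K C0 by (intro mult_right_mono) (auto simp: field_simps mult_le_cancel_left1)
    finally have "\<bar>W (Suc n) x\<bar> \<le> C * (1/2) ^ (Suc n) * exp (K * x)" .
    moreover have "Q * C * (1/2) ^ n * exp (K * x) \<le> K * C * (1/2) ^ (Suc n) * exp (K * x)"
      using mult_right_mono[OF K(3) mult_nonneg_nonneg[OF C0 exp_ge_zero[of "K * x"]]]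
      by (simp add: mult_ac)
    ultimately show ?case using V[OF Suc.prems] Z[OF Suc.prems] by linarith
  qed
  have KC: "C * (1/2) ^ n * exp (K * x) \<le> K * C * (1/2) ^ n * exp (K * x)" for n x
    using mult_right_mono[of 1 K "C * (1/2) ^ n * exp (K * x)"] K by (simp add: C_def mult_ac)
  let ?w = "\<lambda>x. \<Sum>n. W n x" and ?v = "\<lambda>x. \<Sum>n. V n x"
  have w': "(?w has_real_derivative ?v t) (at t within {0..})" if "0 \<le> t" for t
    by (rule series_has_derivative_atLeast[OF W' _ _ K(1) that]) (use bd in blast)+
  have v': "(?v has_real_derivative (\<Sum>n. Z n t)) (at t within {0..})" if "0 \<le> t" for t
  proof (rule series_has_derivative_atLeast[OF V' _ _ K(1) that])
    fix n x assume x: "(0::real) \<le> x"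
    show "\<bar>V n x\<bar> \<le> K * C * (1/2) ^ n * exp (K * x)" using bd[OF x] KC order_trans by blast
    show "\<bar>Z n x\<bar> \<le> K * C * (1/2) ^ n * exp (K * x)" using bd[OF x] by blast
  qed
  have sm: "summable (\<lambda>n. W n t)" if "0 \<le> t" for t
  proof (rule summable_comparison_test')
    show "summable (\<lambda>n. C * exp (K * t) * (1/2) ^ n)"
      by (intro summable_mult summable_geometric) auto
    show "norm (W n t) \<le> C * exp (K * t) * (1/2) ^ n" for n
      using bd[OF that] by (simp add: mult_ac)
  qed
  have Zsum: "(\<Sum>n. Z n t) = q t * ?w t" if "0 \<le> t" for t
  proof -
    have "(\<lambda>n. q t * W n t) sums (q t * ?w t)"
      using sm[OF that] by (intro sums_mult summable_sums)
    then have "(\<lambda>n. Z (Suc n) t) sums (q t * ?w t)" by (simp add: Z_def)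
    then have "(\<lambda>n. Z n t) sums (q t * ?w t + Z 0 t)" by (rule sums_Suc)
    then show ?thesis by (simp add: Z_def sums_iff)
  qed
  have z: "W (Suc n) 0 = 0" "V (Suc n) 0 = 0" for n
    by (auto simp: WS VS intro!: I0 Vc Zc simp del: VS, simp add: VS I0 Zc)
  have "(\<lambda>n. W n 0) sums (\<Sum>n<1. W n 0)" "(\<lambda>n. V n 0) sums (\<Sum>n<1. V n 0)"
    by (rule sums_finite; use z in \<open>auto simp: gr0_conv_Suc\<close>)+
  then have "?w 0 = x0" "?v 0 = y0" by (auto simp: sums_iff W0 V_def)
  then show ?thesis using w' v' Zsum by (intro exI[of _ ?w] exI[of _ ?v]) auto
qed

section \<open>Damped modes and their dependence on the speed\<close>

definition mode_solution ::
  "real \<Rightarrow> real \<Rightarrow> (real \<Rightarrow> real) \<Rightarrow> (real \<Rightarrow> real) \<Rightarrow> (real \<Rightarrow> real) \<Rightarrow> bool" where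
  "mode_solution b l c u v \<longleftrightarrow>
     (\<forall>t\<ge>0. (u has_real_derivative v t) (at t within {0..}) \<and>
       (v has_real_derivative - 2 * b * v t - c t * l\<^sup>2 * u t) (at t within {0..}))"

text \<open>The substitution \<open>u t = exp (- b * t) * w t\<close> removes the damping and leaves
  \<open>w'' = q w\<close> with \<open>q = b\<^sup>2 - c l\<^sup>2\<close>. The speed is continued
  to the left by its value at 0, because the Picard construction works with coefficients on the
  whole line.\<close>

lemma mode_solution_exists:
  fixes c :: "real \<Rightarrow> real"
  assumes c: "continuous_on {0..} c" and M: "\<And>t. 0 \<le> t \<Longrightarrow> \<bar>c t\<bar> \<le> M"
  shows "\<exists>u v. mode_solution b l c u v \<and> u 0 = x0 \<and> v 0 = y0"
proof -
  define q where "q t = b\<^sup>2 - c (max 0 t) * l\<^sup>2" for t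
  have "continuous_on UNIV (\<lambda>t. c (max 0 t))"
    by (rule continuous_on_compose2[OF c]) (auto intro!: continuous_intros)
  then have q: "continuous_on UNIV q" unfolding q_def by (intro continuous_intros)
  have qQ: "\<bar>q t\<bar> \<le> b\<^sup>2 + M * l\<^sup>2" for t
  proof -
    have "\<bar>c (max 0 t) * l\<^sup>2\<bar> \<le> M * l\<^sup>2" using M[of "max 0 t"] by (simp add: abs_mult mult_right_mono)
    then show ?thesis unfolding q_def by (smt (verit) zero_le_power2)
  qed
  obtain w w' where w0: "w 0 = x0" "w' 0 = y0 + b * x0" and
    w: "\<And>t. t \<ge> 0 \<Longrightarrow> (w has_real_derivative w' t) (at t within {0..})" and
    w': "\<And>t. t \<ge> 0 \<Longrightarrow> (w' has_real_derivative q t * w t) (at t within {0..})"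
    using second_order_ode_exists[OF q qQ, of x0 "y0 + b * x0"] by blast
  define u where "u t = exp (- b * t) * w t" for t
  define v where "v t = exp (- b * t) * (w' t - b * w t)" for t
  have "(u has_real_derivative v t) (at t within {0..})" if "0 \<le> t" for t
    unfolding u_def v_def using that
    by (auto intro!: derivative_eq_intros w simp: algebra_simps)
  moreover have "(v has_real_derivative - 2 * b * v t - c t * l\<^sup>2 * u t) (at t within {0..})"
    if "0 \<le> t" for t
    unfolding u_def v_def using that
    by (auto intro!: derivative_eq_intros w w' simp: algebra_simps power2_eq_square q_def)
  ultimately show ?thesis
    unfolding mode_solution_def by (intro exI[of _ u] exI[of _ v]) (auto simp: u_def v_def w0)
qed

lemma mode_solution_continuous:
  assumes "mode_solution b l c u v"
  shows "continuous_on {0..} u" "continuous_on {0..} v"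
  using assms unfolding mode_solution_def
  by (auto intro!: DERIV_continuous_on)

text \<open>Gronwall for the energy of the difference. It solves the equation with speed
  \<open>d\<close> and source \<open>(c t - d t) * l\<^sup>2 * u t\<close>, so only the reference
  solution \<open>u\<close> has to be bounded beforehand; the damping contributes with a favourable
  sign. For a fixed mode and time span the bound vanishes with \<open>e\<close>.\<close>

lemma mode_solution_stability:
  assumes c: "mode_solution b l c u v" and d: "mode_solution b l d u' v'"
    and "0 \<le> b" and init: "u' 0 = u 0" "v' 0 = v 0"
    and M: "\<And>t. 0 \<le> t \<Longrightarrow> \<bar>d t\<bar> \<le> M"
    and e: "\<And>t. 0 \<le> t \<Longrightarrow> \<bar>c t - d t\<bar> \<le> e"
    and B: "\<And>t. 0 \<le> t \<Longrightarrow> t \<le> T \<Longrightarrow> \<bar>u t\<bar> \<le> B"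
    and t: "0 \<le> t" "t \<le> T"
  shows "(u t - u' t)\<^sup>2 + (v t - v' t)\<^sup>2 \<le> (e * l\<^sup>2 * B)\<^sup>2 * exp ((2 + M * l\<^sup>2) * T)"
proof -
  define K where "K = 2 + M * l\<^sup>2"
  define R where "R = (e * l\<^sup>2 * B)\<^sup>2"
  define p where "p t = u t - u' t" for t
  define q where "q t = v t - v' t" for t
  have M0: "0 \<le> M" and e0: "0 \<le> e" and B0: "0 \<le> B"
    using M[of 0] e[of 0] B[of 0] t by auto
  have K: "1 \<le> K" using M0 by (simp add: K_def add_nonneg_nonneg)
  \<comment> \<open>The energy \<open>E\<close> satisfies \<open>E' \<le> K * E + R\<close>, and
    adding \<open>R / K\<close> absorbs the source. In \<open>K\<close>, one unit comes from
    \<open>2 * p * q\<close>, one from Young's inequality for the source, and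
    \<open>M * l\<^sup>2\<close> from the term with \<open>d\<close>.\<close>
  define G where "G t = exp (- K * t) * ((p t)\<^sup>2 + (q t)\<^sup>2 + R / K)" for t
  have "G t \<le> G 0"
  proof (rule DERIV_nonpos_imp_decreasing_open[OF t(1)])
    fix x assume x: "0 < x" "x < t"
    have at: "at x within {0..} = at x"
      by (rule at_within_interior) (use x in \<open>auto simp: interior_real_atLeast\<close>)
    define z where "z = - 2 * b * q x - d x * l\<^sup>2 * p x - (c x - d x) * l\<^sup>2 * u x"
    have p': "(p has_real_derivative q x) (at x)" and q': "(q has_real_derivative z) (at x)"
      using c d x unfolding mode_solution_def p_def q_def z_def
      by (auto intro!: derivative_eq_intros simp: at[symmetric] algebra_simps)
    have "(G has_real_derivative exp (- K * x) * (2 * p x * q x + 2 * q x * z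
        - K * ((p x)\<^sup>2 + (q x)\<^sup>2) - R)) (at x)"
      unfolding G_def using K
      by (auto intro!: derivative_eq_intros p' q' simp: algebra_simps)
    moreover have "2 * p x * q x + 2 * q x * z - K * ((p x)\<^sup>2 + (q x)\<^sup>2) - R \<le> 0"
    proof -
      have 1: "2 * \<bar>p x * q x\<bar> \<le> (p x)\<^sup>2 + (q x)\<^sup>2"
        using sum_squares_bound[of "\<bar>p x\<bar>" "\<bar>q x\<bar>"] by (simp add: abs_mult)
      have "- (2 * (d x * l\<^sup>2) * (p x * q x)) \<le> \<bar>2 * (d x * l\<^sup>2) * (p x * q x)\<bar>" by linarith
      also have "\<dots> = (\<bar>d x\<bar> * l\<^sup>2) * (2 * \<bar>p x * q x\<bar>)" by (simp add: abs_mult)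
      also have "\<dots> \<le> (M * l\<^sup>2) * ((p x)\<^sup>2 + (q x)\<^sup>2)"
        using M[of x] x 1 M0 by (intro mult_mono mult_right_mono) auto
      finally have 2: "- (2 * (d x * l\<^sup>2) * (p x * q x)) \<le> (M * l\<^sup>2) * ((p x)\<^sup>2 + (q x)\<^sup>2)" .
      have "\<bar>(c x - d x) * l\<^sup>2 * u x\<bar> \<le> e * l\<^sup>2 * B"
        unfolding abs_mult using e[of x] B[of x] x t e0 by (intro mult_mono) auto
      then have "((c x - d x) * l\<^sup>2 * u x)\<^sup>2 \<le> R"
        unfolding R_def by (rule abs_le_square_iff[THEN iffD1, OF order_trans]) auto
      then have 3: "- (2 * q x * ((c x - d x) * l\<^sup>2 * u x)) \<le> (q x)\<^sup>2 + R"
        using zero_le_power2[of "q x + (c x - d x) * l\<^sup>2 * u x"] unfolding power2_sum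
        by linarith
      have 4: "0 \<le> 4 * b * (q x)\<^sup>2" using \<open>0 \<le> b\<close> by simp
      have sq: "X + y - b4 - w - 2 * D - m - R \<le> 0"
        if "X \<le> P + Q'" "w' \<le> m" "y \<le> Q' + R" "0 \<le> b4" "0 \<le> P" "D = P + Q'" "w' = - w"
        for X P Q' y w w' m b4 D :: real
        using that by linarith
      have "2 * p x * q x + 2 * q x * z - K * ((p x)\<^sup>2 + (q x)\<^sup>2) - R
        = 2 * (p x * q x) + - (2 * q x * ((c x - d x) * l\<^sup>2 * u x)) - 4 * b * (q x)\<^sup>2
          - 2 * (d x * l\<^sup>2) * (p x * q x) - 2 * ((p x)\<^sup>2 + (q x)\<^sup>2)
          - (M * l\<^sup>2) * ((p x)\<^sup>2 + (q x)\<^sup>2) - R"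
        by (simp add: z_def K_def algebra_simps power2_eq_square)
      also have "\<dots> \<le> 0"
        by (rule sq[OF _ 2 3 4 zero_le_power2 refl refl]) (use 1 in linarith)
      finally show ?thesis .
    qed
    ultimately show "\<exists>y. (G has_real_derivative y) (at x) \<and> y \<le> 0"
      by (meson exp_ge_zero mult_nonneg_nonpos)
  next
    have "continuous_on {0..t} w" if "continuous_on {0..} w" for w :: "real \<Rightarrow> real"
      using that by (rule continuous_on_subset) auto
    then show "continuous_on {0..t} G"
      unfolding G_def p_def q_def
      using mode_solution_continuous[OF c] mode_solution_continuous[OF d]
      by (intro continuous_intros) auto
  qed
  also have "G 0 = R / K" by (simp add: G_def p_def q_def init)
  finally have "exp (- K * t) * ((p t)\<^sup>2 + (q t)\<^sup>2 + R / K) \<le> R / K" by (simp add: G_def)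
  then have "exp (K * t) * (exp (- K * t) * ((p t)\<^sup>2 + (q t)\<^sup>2 + R / K)) \<le> exp (K * t) * (R / K)"
    by (rule mult_left_mono) auto
  moreover have "exp (K * t) * (exp (- K * t) * y) = y" for y :: real
    by (simp add: exp_minus field_simps)
  ultimately have "(p t)\<^sup>2 + (q t)\<^sup>2 + R / K \<le> exp (K * t) * (R / K)" by metis
  also have "\<dots> \<le> exp (K * T) * R"
    using t K by (intro mult_mono) (auto simp: R_def divide_le_eq mult_le_cancel_left1)
  finally have "(p t)\<^sup>2 + (q t)\<^sup>2 \<le> exp (K * T) * R"
    using K by (smt (verit) R_def divide_nonneg_nonneg zero_le_power2)
  then show ?thesis by (simp add: p_def q_def K_def R_def mult_ac)
qed

section \<open>Hoelder functions and smoothing\<close>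

text \<open>Posed on the whole line, unlike \<open>PS\<close>, so that translates and two-sided
  derivatives need no care at 0.\<close>

definition holder :: "real \<Rightarrow> real \<Rightarrow> (real \<Rightarrow> real) \<Rightarrow> bool" where
  "holder a K f \<longleftrightarrow> (\<forall>s t. \<bar>f t - f s\<bar> \<le> K * \<bar>t - s\<bar> powr a)"

lemma holderD: "holder a K f \<Longrightarrow> \<bar>f t - f s\<bar> \<le> K * \<bar>t - s\<bar> powr a"
  by (simp add: holder_def)

lemma holder_nonneg: "holder a K f \<Longrightarrow> 0 \<le> K"
  using holderD[of a K f 1 0] by simp

lemma holder_mono: "holder a K f \<Longrightarrow> K \<le> L \<Longrightarrow> holder a L f"
  unfolding holder_def by (meson mult_right_mono order_trans powr_ge_zero)

lemma holder_const: "0 \<le> K \<Longrightarrow> holder a K (\<lambda>_. x)"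
  by (simp add: holder_def)

lemma holder_add:
  assumes "holder a K f" "holder a L g"
  shows "holder a (K + L) (\<lambda>t. f t + g t)"
  unfolding holder_def
proof (intro allI)
  fix s t
  show "\<bar>f t + g t - (f s + g s)\<bar> \<le> (K + L) * \<bar>t - s\<bar> powr a"
    using holderD[OF assms(1), of t s] holderD[OF assms(2), of t s]
    by (simp add: distrib_right)
qed

lemma holder_cmult:
  assumes "holder a K f"
  shows "holder a (\<bar>x\<bar> * K) (\<lambda>t. x * f t)"
  unfolding holder_def
proof (intro allI)
  fix s t
  show "\<bar>x * f t - x * f s\<bar> \<le> \<bar>x\<bar> * K * \<bar>t - s\<bar> powr a"
    using mult_left_mono[OF holderD[OF assms, of t s], of "\<bar>x\<bar>"]
    by (simp add: abs_mult[symmetric] right_diff_distrib mult_ac)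
qed

lemma holder_diff:
  assumes "holder a K f" "holder a L g"
  shows "holder a (K + L) (\<lambda>t. f t - g t)"
  using holder_add[OF assms(1) holder_cmult[OF assms(2), of "-1"]] by simp

lemma holder_mult:
  assumes f: "holder a K f" and g: "holder a L g"
    and A: "\<And>t. \<bar>f t\<bar> \<le> A" and B: "\<And>t. \<bar>g t\<bar> \<le> B"
  shows "holder a (A * L + B * K) (\<lambda>t. f t * g t)"
  unfolding holder_def
proof (intro allI)
  fix s t
  have "f t * g t - f s * g s = f t * (g t - g s) + g s * (f t - f s)"
    by (simp add: algebra_simps)
  then have "\<bar>f t * g t - f s * g s\<bar> \<le> \<bar>f t\<bar> * \<bar>g t - g s\<bar> + \<bar>g s\<bar> * \<bar>f t - f s\<bar>"
    by (metis abs_mult abs_triangle_ineq)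
  also have "\<dots> \<le> A * (L * \<bar>t - s\<bar> powr a) + B * (K * \<bar>t - s\<bar> powr a)"
    using A[of t] B[of s] holderD[OF f, of t s] holderD[OF g, of t s] by (intro add_mono mult_mono) auto
  finally show "\<bar>f t * g t - f s * g s\<bar> \<le> (A * L + B * K) * \<bar>t - s\<bar> powr a"
    by (simp add: algebra_simps)
qed

lemma holder_continuous:
  assumes "holder a K f" "0 < a"
  shows "continuous_on UNIV f"
proof -
  have "(f \<longlongrightarrow> f s) (at s)" for s
  proof -
    have "((\<lambda>t. K * \<bar>t - s\<bar> powr a) \<longlongrightarrow> K * \<bar>s - s\<bar> powr a) (at s)"
      using assms(2) by (intro tendsto_intros tendsto_powr') auto
    then have "((\<lambda>t. K * \<bar>t - s\<bar> powr a) \<longlongrightarrow> 0) (at s)" by simp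
    then have "((\<lambda>t. f t - f s) \<longlongrightarrow> 0) (at s)"
      by (rule Lim_null_comparison[rotated]) (use holderD[OF assms(1)] in auto)
    then show ?thesis by (simp add: Lim_null[of f "f s"])
  qed
  then show ?thesis by (simp add: continuous_on_def)
qed

lemma lipschitz_of_deriv_bound:
  fixes f :: "real \<Rightarrow> real"
  assumes "\<And>t. (f has_real_derivative f' t) (at t)" and "\<And>t. \<bar>f' t\<bar> \<le> L"
  shows "\<bar>f t - f s\<bar> \<le> L * \<bar>t - s\<bar>"
  using field_differentiable_bound[of UNIV f f' L t s] assms by simp

text \<open>Interpolation: an increment \<open>x\<close> equals
  \<open>x powr (1 - a) * x powr a\<close>; the first factor is bounded by the sup bound, the second
  by the Lipschitz bound. For oscillations of frequency of order \<open>l\<close> this yields a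
  Hoelder constant of order \<open>l powr a\<close>.\<close>

lemma bounded_lipschitz_holder:
  assumes B: "\<And>t. \<bar>f t\<bar> \<le> B" and L: "\<And>s t. \<bar>f t - f s\<bar> \<le> L * \<bar>t - s\<bar>" and a: "0 < a" "a < 1"
  shows "holder a ((2 * B) powr (1 - a) * L powr a) f"
  unfolding holder_def
proof (intro allI)
  fix s t
  define x where "x = \<bar>f t - f s\<bar>"
  have x: "0 \<le> x" "x \<le> 2 * B" "x \<le> L * \<bar>t - s\<bar>"
    using B[of t] B[of s] L[of t s] by (auto simp: x_def)
  have L0: "0 \<le> L" using L[of 1 0] by auto
  have "x = x powr (1 - a) * x powr a"
    using x(1) by (cases "x = 0") (auto simp: powr_add[symmetric])
  also have "\<dots> \<le> (2 * B) powr (1 - a) * (L * \<bar>t - s\<bar>) powr a"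
    using x a by (intro mult_mono powr_mono2) auto
  also have "\<dots> = (2 * B) powr (1 - a) * L powr a * \<bar>t - s\<bar> powr a"
    using L0 by (simp add: powr_mult)
  finally show "\<bar>f t - f s\<bar> \<le> (2 * B) powr (1 - a) * L powr a * \<bar>t - s\<bar> powr a"
    by (simp add: x_def)
qed

text \<open>Qualitative on purpose: for \<open>\<gamma>1 / (4 * \<gamma>)\<close> and its derivative
  only the existence of constants matters, since they are fixed before the frequency tends to
  infinity.\<close>

definition bounded_holder :: "real \<Rightarrow> (real \<Rightarrow> real) \<Rightarrow> bool" where
  "bounded_holder a f \<longleftrightarrow> (\<exists>B K. (\<forall>t. \<bar>f t\<bar> \<le> B) \<and> holder a K f)"

lemma bounded_holder_mult:
  "bounded_holder a f \<Longrightarrow> bounded_holder a g \<Longrightarrow> bounded_holder a (\<lambda>t. f t * g t)"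
  unfolding bounded_holder_def
proof (elim exE conjE)
  fix A K B L assume *: "\<forall>t. \<bar>f t\<bar> \<le> A" "holder a K f" "\<forall>t. \<bar>g t\<bar> \<le> B" "holder a L g"
  have "\<bar>f t * g t\<bar> \<le> A * B" for t
    unfolding abs_mult using * by (meson abs_ge_zero mult_mono order_trans)
  then show "\<exists>B K. (\<forall>t. \<bar>f t * g t\<bar> \<le> B) \<and> holder a K (\<lambda>t. f t * g t)"
    using holder_mult[OF *(2,4)] * by blast
qed

lemma bounded_holder_diff:
  "bounded_holder a f \<Longrightarrow> bounded_holder a g \<Longrightarrow> bounded_holder a (\<lambda>t. f t - g t)"
  unfolding bounded_holder_def
proof (elim exE conjE)
  fix A K B L assume *: "\<forall>t. \<bar>f t\<bar> \<le> A" "holder a K f" "\<forall>t. \<bar>g t\<bar> \<le> B" "holder a L g"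
  have "\<bar>f t - g t\<bar> \<le> A + B" for t
    using *(1)[rule_format, of t] *(3)[rule_format, of t] by linarith
  then show "\<exists>B K. (\<forall>t. \<bar>f t - g t\<bar> \<le> B) \<and> holder a K (\<lambda>t. f t - g t)"
    using holder_diff[OF *(2,4)] by blast
qed

lemma bounded_holder_cmult: "bounded_holder a f \<Longrightarrow> bounded_holder a (\<lambda>t. x * f t)"
  by (rule bounded_holder_mult)
    (use holder_const[of 0] in \<open>auto simp: bounded_holder_def\<close>)

lemma bounded_holder_inverse:
  assumes f: "holder a K f" and m: "0 < m" "\<And>t. m \<le> f t"
  shows "bounded_holder a (\<lambda>t. inverse (f t))"
proof -
  have pos: "0 < f t" for t using m(1) m(2)[of t] by linarith
  have "\<bar>inverse (f t)\<bar> \<le> inverse m" for t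
    using m(2)[of t] m(1) pos[of t] by (simp add: le_imp_inverse_le)
  moreover have "holder a (K / m\<^sup>2) (\<lambda>t. inverse (f t))"
    unfolding holder_def
  proof (intro allI)
    fix s t
    have "inverse (f t) - inverse (f s) = (f s - f t) / (f t * f s)"
      using pos[of s] pos[of t] by (simp add: field_simps)
    then have "\<bar>inverse (f t) - inverse (f s)\<bar> = \<bar>f t - f s\<bar> / (f t * f s)"
      using pos[of s] pos[of t] by (simp add: abs_mult abs_minus_commute)
    also have "\<dots> \<le> (K * \<bar>t - s\<bar> powr a) / m\<^sup>2"
      unfolding power2_eq_square using holderD[OF f, of t s] m
      by (intro frac_le mult_mono) (auto intro: less_imp_le pos)
    finally show "\<bar>inverse (f t) - inverse (f s)\<bar> \<le> K / m\<^sup>2 * \<bar>t - s\<bar> powr a" by simp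
  qed
  ultimately show ?thesis unfolding bounded_holder_def by blast
qed

lemma holder_sqrt:
  assumes f: "holder a K f" and m: "0 < m" "\<And>t. m \<le> f t"
  shows "holder a (K / sqrt m) (\<lambda>t. sqrt (f t))"
  unfolding holder_def
proof (intro allI)
  fix s t
  have pos: "0 < f t" for t using m(1) m(2)[of t] by linarith
  have sq: "sqrt m \<le> sqrt (f s) + sqrt (f t)" using m by (smt (verit) real_sqrt_ge_zero real_sqrt_le_iff)
  have "(sqrt (f t) - sqrt (f s)) * (sqrt (f s) + sqrt (f t)) = f t - f s"
    using pos[of s] pos[of t] by (simp add: algebra_simps)
  then have "\<bar>sqrt (f t) - sqrt (f s)\<bar> * \<bar>sqrt (f s) + sqrt (f t)\<bar> = \<bar>f t - f s\<bar>"
    by (metis abs_mult)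
  then have "\<bar>sqrt (f t) - sqrt (f s)\<bar> * sqrt m \<le> \<bar>f t - f s\<bar>"
    using sq by (smt (verit) abs_ge_zero mult_left_mono)
  also have "\<dots> \<le> K * \<bar>t - s\<bar> powr a" by (rule holderD[OF f])
  finally show "\<bar>sqrt (f t) - sqrt (f s)\<bar> \<le> K / sqrt m * \<bar>t - s\<bar> powr a"
    using m(1) by (simp add: field_simps)
qed

text \<open>At short range the Lipschitz bound makes f negligible, at long range the sup bound makes
  p negligible; so the two Hoelder constants never have to be added.\<close>

lemma holder_perturbation:
  assumes f: "holder a K f" and L: "\<And>s t. \<bar>f t - f s\<bar> \<le> L * \<bar>t - s\<bar>"
    and "K < H" "0 < H" "0 < a" "a < 1"
  shows "\<exists>e>0. \<forall>p. (\<forall>t. \<bar>p t\<bar> \<le> e) \<longrightarrow> holder a (H / 2) p \<longrightarrow> holder a H (\<lambda>t. f t + p t)"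
proof -
  \<comment> \<open>The distance at which the Lipschitz bound of \<open>f\<close> uses up
    \<open>H / 2\<close> of the Hoelder constant; \<open>\<bar>L\<bar> + 1\<close> avoids division
    by zero.\<close>
  define \<tau> where "\<tau> = (H / (2 * (\<bar>L\<bar> + 1))) powr (1 / (1 - a))"
  have \<tau>: "0 < \<tau>" using \<open>0 < H\<close> by (auto simp: \<tau>_def)
  have "\<tau> powr (1 - a) = H / (2 * (\<bar>L\<bar> + 1))"
    using \<open>a < 1\<close> \<open>0 < H\<close> by (simp add: \<tau>_def powr_powr)
  then have "(\<bar>L\<bar> + 1) * \<tau> powr (1 - a) = H / 2" by (simp add: field_simps)
  then have L\<tau>: "L * \<tau> powr (1 - a) \<le> H / 2"
    by (smt (verit, best) mult_right_mono powr_ge_zero)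
  define e where "e = (H - K) * \<tau> powr a / 2"
  have "holder a H (\<lambda>t. f t + p t)" if pe: "\<And>t. \<bar>p t\<bar> \<le> e" and p: "holder a (H / 2) p" for p
    unfolding holder_def
  proof (intro allI)
    fix s t
    show "\<bar>f t + p t - (f s + p s)\<bar> \<le> H * \<bar>t - s\<bar> powr a"
    proof (cases "\<bar>t - s\<bar> \<le> \<tau>")
      case True
      have "\<bar>f t - f s\<bar> \<le> L * \<bar>t - s\<bar>" by (rule L)
      also have "\<bar>t - s\<bar> = \<bar>t - s\<bar> powr (1 - a) * \<bar>t - s\<bar> powr a"
        by (cases "t = s") (auto simp: powr_add[symmetric])
      also have "L * \<dots> = (L * \<bar>t - s\<bar> powr (1 - a)) * \<bar>t - s\<bar> powr a" by simp
      also have "\<dots> \<le> (H / 2) * \<bar>t - s\<bar> powr a"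
      proof (rule mult_right_mono)
        have "L * \<bar>t - s\<bar> powr (1 - a) \<le> L * \<tau> powr (1 - a)"
          using True L[of 1 0] \<open>a < 1\<close> by (intro mult_left_mono powr_mono2) auto
        then show "L * \<bar>t - s\<bar> powr (1 - a) \<le> H / 2" using L\<tau> by linarith
      qed auto
      finally show ?thesis using holderD[OF p, of t s] by linarith
    next
      case False
      have "\<bar>p t - p s\<bar> \<le> (H - K) * \<tau> powr a" using pe[of t] pe[of s] by (simp add: e_def)
      also have "\<dots> \<le> (H - K) * \<bar>t - s\<bar> powr a"
        using False \<tau> \<open>K < H\<close> \<open>0 < a\<close> by (intro mult_left_mono powr_mono2) auto
      finally show ?thesis using holderD[OF f, of t s] by (simp add: left_diff_distrib)
    qed
  qed
  moreover have "0 < e" using \<tau> \<open>K < H\<close> by (simp add: e_def)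
  ultimately show ?thesis by blast
qed

section \<open>Smoothing a speed while keeping its bounds and Hoelder constant\<close>

lemma steklov_average:
  assumes f: "holder a K f" and a: "0 < a" and h: "0 < h" and m: "\<And>t. m \<le> f t" "\<And>t. f t \<le> M"
  shows "\<exists>F. (\<forall>t. (F has_real_derivative (f (t + h) - f t) / h) (at t)) \<and> holder a K F \<and>
    (\<forall>t. m \<le> F t \<and> F t \<le> M) \<and> (\<forall>t. \<bar>F t - f t\<bar> \<le> K * h powr a)"
proof -
  obtain G where G: "\<And>t. (G has_real_derivative f t) (at t)"
    using antiderivative_exists[OF holder_continuous[OF f a]] by blast
  have K: "0 \<le> K" using f by (rule holder_nonneg)
  define F where "F t = (G (t + h) - G t) / h" for t
  have G_shift: "((\<lambda>t. G (t + d)) has_real_derivative f (t + d)) (at t)" for t d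
    using DERIV_shift[of G "f (t + d)" t d] G by simp
  have F': "(F has_real_derivative (f (t + h) - f t) / h) (at t)" for t
    unfolding F_def by (intro DERIV_cdivide DERIV_diff G G_shift)
  \<comment> \<open>The mean over \<open>[t, t + h]\<close> is a value of \<open>f\<close> in that
    interval, which preserves the bounds and controls the distance to \<open>f t\<close>.\<close>
  have Fx: "\<exists>x. t < x \<and> x < t + h \<and> F t = f x" for t
  proof -
    have "\<exists>x>t. x < t + h \<and> G (t + h) - G t = (t + h - t) * f x"
      by (rule MVT2) (use h G in auto)
    then show ?thesis using h by (auto simp: F_def)
  qed
  have mM: "m \<le> F t \<and> F t \<le> M" for t using Fx[of t] m by metis
  have near: "\<bar>F t - f t\<bar> \<le> K * h powr a" for t
  proof -
    obtain x where x: "t < x" "x < t + h" "F t = f x" using Fx by blast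
    have "\<bar>f x - f t\<bar> \<le> K * \<bar>x - t\<bar> powr a" by (rule holderD[OF f])
    also have "\<dots> \<le> K * h powr a" using x a K by (intro mult_left_mono powr_mono2) auto
    finally show ?thesis using x by simp
  qed
  have "\<bar>F t - F s\<bar> \<le> K * \<bar>t - s\<bar> powr a" for s t
  proof -
    define d where "d = t - s"
    \<comment> \<open>The mean value theorem is applied to the difference of two translates, so both
      are evaluated at the same point \<open>x\<close> and the constant \<open>K\<close> is not
      enlarged.\<close>
    have "\<exists>x>s. x < s + h \<and> (\<lambda>y. G (y + d) - G y) (s + h) - (\<lambda>y. G (y + d) - G y) s
        = (s + h - s) * (f (x + d) - f x)"
      by (rule MVT2) (use h in \<open>auto intro!: DERIV_diff G G_shift\<close>)
    then obtain x where "G (s + h + d) - G (s + h) - (G (s + d) - G s) = h * (f (x + d) - f x)"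
      by auto
    moreover have "s + h + d = t + h" "s + d = t" by (auto simp: d_def)
    ultimately have "G (t + h) - G t - (G (s + h) - G s) = h * (f (x + d) - f x)" by simp
    then have "F t - F s = f (x + d) - f x"
      using h by (simp add: F_def diff_divide_distrib[symmetric])
    then show ?thesis using holderD[OF f, of "x + d" x] by (simp add: d_def)
  qed
  then have "holder a K F" by (simp add: holder_def)
  then show ?thesis using F' mM near by blast
qed

text \<open>Contraction towards the midpoint of the bounds makes all three inequalities of
  \<open>PS\<close> strict; two Steklov averages then give two derivatives. The second derivative
  must itself be Hoelder, because it enters the resonant speed and that speed has to be
  Hoelder.\<close>

lemma smooth_approximation:
  assumes c: "c \<in> PS \<mu>1 \<mu>2 \<alpha> H" and "0 < \<mu>1" "\<mu>1 < \<mu>2" "0 < \<alpha>" "0 < H" "0 < \<epsilon>"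
  shows "\<exists>\<gamma> \<gamma>1 \<gamma>2 K L m M. (\<forall>t. (\<gamma> has_real_derivative \<gamma>1 t) (at t)) \<and>
    (\<forall>t. (\<gamma>1 has_real_derivative \<gamma>2 t) (at t)) \<and>
    holder \<alpha> K \<gamma> \<and> K < H \<and> holder \<alpha> L \<gamma>2 \<and>
    (\<forall>t. \<bar>\<gamma>1 t\<bar> \<le> L \<and> \<bar>\<gamma>2 t\<bar> \<le> L \<and> m \<le> \<gamma> t \<and> \<gamma> t \<le> M) \<and> \<mu>1 < m \<and> M < \<mu>2 \<and>
    (\<forall>t\<ge>0. \<bar>\<gamma> t - c t\<bar> \<le> \<epsilon>)"
proof -
  \<comment> \<open>Error budget: at most \<open>\<epsilon> / 2\<close> for the contraction and,
    since \<open>H * h powr \<alpha> = \<epsilon> / 4\<close> below, at most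
    \<open>\<epsilon> / 4\<close> for each of the two averages.\<close>
  define \<eta> where "\<eta> = min (1/2) (\<epsilon> / (2 * (\<mu>2 - \<mu>1)))"
  have \<eta>: "0 < \<eta>" "\<eta> < 1" "\<eta> * (\<mu>2 - \<mu>1) \<le> \<epsilon> / 2"
    using assms by (auto simp: \<eta>_def min_def field_simps)
  define h where "h = (\<epsilon> / (4 * H)) powr (1 / \<alpha>)"
  have h: "0 < h" "h powr \<alpha> = \<epsilon> / (4 * H)"
    using assms by (auto simp: h_def powr_powr)
  define f where "f t = (1 - \<eta>) * c (max 0 t) + \<eta> * ((\<mu>1 + \<mu>2) / 2)" for t
  define K where "K = (1 - \<eta>) * H"
  define m where "m = (1 - \<eta>) * \<mu>1 + \<eta> * ((\<mu>1 + \<mu>2) / 2)"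
  define M where "M = (1 - \<eta>) * \<mu>2 + \<eta> * ((\<mu>1 + \<mu>2) / 2)"
  have "m - \<mu>1 = \<eta> * ((\<mu>2 - \<mu>1) / 2)" "\<mu>2 - M = \<eta> * ((\<mu>2 - \<mu>1) / 2)"
    by (simp_all add: m_def M_def field_simps)
  moreover have "0 < \<eta> * ((\<mu>2 - \<mu>1) / 2)" using \<eta> assms by simp
  ultimately have mM: "\<mu>1 < m" "M < \<mu>2" by linarith+
  have cb: "\<mu>1 \<le> c (max 0 t)" "c (max 0 t) \<le> \<mu>2" for t using c by (auto simp: PS_def)
  have fb: "m \<le> f t" "f t \<le> M" for t
    using cb[of t] \<eta> by (auto simp: f_def m_def M_def intro!: mult_left_mono)
  have "holder \<alpha> H (\<lambda>t. c (max 0 t))"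
    unfolding holder_def
  proof (intro allI)
    fix s t :: real
    have "\<bar>c (max 0 t) - c (max 0 s)\<bar> \<le> H * \<bar>max 0 t - max 0 s\<bar> powr \<alpha>"
      using c by (auto simp: PS_def)
    also have "\<dots> \<le> H * \<bar>t - s\<bar> powr \<alpha>"
      using assms by (intro mult_left_mono powr_mono2) auto
    finally show "\<bar>c (max 0 t) - c (max 0 s)\<bar> \<le> H * \<bar>t - s\<bar> powr \<alpha>" .
  qed
  from holder_add[OF holder_cmult[OF this, of "1 - \<eta>"] holder_const[of 0]]
  have f: "holder \<alpha> K f" using \<eta> by (simp add: f_def[abs_def] K_def)
  have K: "0 \<le> K" "K < H" using \<eta> assms by (auto simp: K_def)
  obtain F1 where F1': "\<And>t. (F1 has_real_derivative (f (t + h) - f t) / h) (at t)"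
    and F1: "holder \<alpha> K F1" and F1b: "\<And>t. m \<le> F1 t" "\<And>t. F1 t \<le> M"
    and F1n: "\<And>t. \<bar>F1 t - f t\<bar> \<le> K * h powr \<alpha>"
    using steklov_average[OF f \<open>0 < \<alpha>\<close> h(1) fb] by blast
  obtain F2 where F2': "\<And>t. (F2 has_real_derivative (F1 (t + h) - F1 t) / h) (at t)"
    and F2: "holder \<alpha> K F2" and F2b: "\<And>t. m \<le> F2 t" "\<And>t. F2 t \<le> M"
    and F2n: "\<And>t. \<bar>F2 t - F1 t\<bar> \<le> K * h powr \<alpha>"
    using steklov_average[OF F1 \<open>0 < \<alpha>\<close> h(1) F1b] by blast
  define \<gamma>1 where "\<gamma>1 t = (F1 (t + h) - F1 t) / h" for t
  \<comment> \<open>A second difference quotient of \<open>f\<close> itself, hence a combination of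
    translates of \<open>f\<close> that inherits its Hoelder exponent.\<close>
  define \<gamma>2 where "\<gamma>2 t = ((f (t + h + h) - f (t + h)) / h - (f (t + h) - f t) / h) / h" for t
  have sh: "((\<lambda>t. F1 (t + h)) has_real_derivative (f (t + h + h) - f (t + h)) / h) (at t)" for t
    using DERIV_shift[of F1 "(f (t + h + h) - f (t + h)) / h" t h] F1'[of "t + h"] by simp
  have \<gamma>1': "(\<gamma>1 has_real_derivative \<gamma>2 t) (at t)" for t
    unfolding \<gamma>1_def \<gamma>2_def by (intro DERIV_cdivide DERIV_diff F1' sh)
  have shf: "holder \<alpha> K (\<lambda>t. f (t + d))" for d
    using f unfolding holder_def by (metis add_diff_cancel_right)
  have \<gamma>2_eq: "\<gamma>2 = (\<lambda>t. (1 / h\<^sup>2) * ((f (t + 2 * h) - f (t + h)) - (f (t + h) - f (t + 0))))"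
    using h by (auto simp: \<gamma>2_def field_simps power2_eq_square fun_eq_iff)
  have \<gamma>2h: "holder \<alpha> (\<bar>1 / h\<^sup>2\<bar> * (K + K + (K + K))) \<gamma>2"
    unfolding \<gamma>2_eq by (intro holder_cmult holder_diff shf)
  define L where "L = \<bar>1 / h\<^sup>2\<bar> * (K + K + (K + K)) + (M - m) / h + 2 * (M - m) / h\<^sup>2"
  have Mm: "0 \<le> M - m" using fb[of 0] by simp
  have L1: "\<bar>\<gamma>1 t\<bar> \<le> L" for t
  proof -
    have "\<bar>\<gamma>1 t\<bar> \<le> (M - m) / h"
      using h F1b[of t] F1b[of "t + h"] by (simp add: \<gamma>1_def divide_right_mono)
    moreover have "0 \<le> 2 * (M - m) / h\<^sup>2" using Mm by simp
    moreover have "0 \<le> \<bar>1 / h\<^sup>2\<bar> * (K + K + (K + K))" using K by simp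
    ultimately show ?thesis by (simp add: L_def)
  qed
  have L2: "\<bar>\<gamma>2 t\<bar> \<le> L" for t
  proof -
    have "\<bar>(f (t + 2 * h) - f (t + h)) - (f (t + h) - f (t + 0))\<bar> \<le> 2 * (M - m)"
      using fb[of "t + 2 * h"] fb[of "t + h"] fb[of "t + 0"] by (smt (verit))
    then have "\<bar>\<gamma>2 t\<bar> \<le> 2 * (M - m) / h\<^sup>2"
      unfolding \<gamma>2_eq by (simp add: abs_mult divide_right_mono)
    moreover have "0 \<le> (M - m) / h" using Mm h by simp
    moreover have "0 \<le> \<bar>1 / h\<^sup>2\<bar> * (K + K + (K + K))" using K by simp
    ultimately show ?thesis by (simp add: L_def)
  qed
  have L3: "holder \<alpha> L \<gamma>2"
    by (rule holder_mono[OF \<gamma>2h]) (use Mm h in \<open>simp add: L_def\<close>)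
  have "\<bar>F2 t - c t\<bar> \<le> \<epsilon>" if "0 \<le> t" for t
  proof -
    have "K * h powr \<alpha> \<le> H * h powr \<alpha>" using K by (intro mult_right_mono) auto
    also have "\<dots> = \<epsilon> / 4" using h assms by simp
    finally have Kh: "K * h powr \<alpha> \<le> \<epsilon> / 4" .
    have "f t - c t = \<eta> * ((\<mu>1 + \<mu>2) / 2 - c t)" using that by (simp add: f_def algebra_simps)
    then have "\<bar>f t - c t\<bar> = \<eta> * \<bar>(\<mu>1 + \<mu>2) / 2 - c t\<bar>" using \<eta> by (simp add: abs_mult)
    also have "\<dots> \<le> \<eta> * (\<mu>2 - \<mu>1)"
      using cb[of t] that \<eta> by (intro mult_left_mono) (auto simp: abs_le_iff field_simps)
    finally show ?thesis using \<eta> F1n[of t] F2n[of t] Kh by linarith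
  qed
  then show ?thesis
    using F2'[folded \<gamma>1_def] \<gamma>1' F2 K(2) L3 L1 L2 F2b mM by blast
qed

section \<open>Resonant perturbation\<close>

text \<open>Written so that \<open>f' / (4 * f)\<close>, the logarithmic derivative of the fourth
  root of \<open>f\<close>, appears: this is the amplitude factor of the WKB approximation and the
  function \<open>g\<close> below.\<close>

lemma has_real_derivative_sqrt_comp:
  assumes "(f has_real_derivative f') (at t)" "0 < f t"
  shows "((\<lambda>t. sqrt (f t)) has_real_derivative 2 * (f' / (4 * f t)) * sqrt (f t)) (at t)"
proof -
  have "sqrt (f t) * sqrt (f t) = f t" using assms(2) by simp
  then have "inverse (sqrt (f t)) / 2 * f' = 2 * (f' / (4 * f t)) * sqrt (f t)"
    using assms(2) by (simp add: field_simps)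
  then show ?thesis
    using DERIV_chain2[OF DERIV_real_sqrt[OF assms(2)] assms(1)] by (simp only:)
qed

text \<open>In \<open>u'' + 2bu'\<close> the factor of \<open>cos \<phi>\<close> is
  \<open>l\<surd>\<gamma> (2g + 2\<psi>' + 2b)\<close>, which the choice of \<open>\<psi>'\<close>
  turns into \<open>2kl\<surd>\<gamma>\<close> times the square of \<open>sin \<phi>\<close>.
  Division by \<open>sin \<phi>\<close> gives one half of the \<open>sin (2 * \<phi>)\<close> term;
  \<open>\<psi>''\<close> gives the other half and \<open>g'\<close>. Completing the square in
  \<open>\<psi>' + b\<close> produces the remaining terms.\<close>

lemma resonant_solution:
  fixes \<gamma> \<gamma>1 \<gamma>2 :: "real \<Rightarrow> real"
  assumes \<gamma>': "\<And>t. (\<gamma> has_real_derivative \<gamma>1 t) (at t)" and \<gamma>1': "\<And>t. (\<gamma>1 has_real_derivative \<gamma>2 t) (at t)"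
    and pos: "\<And>t. 0 < \<gamma> t" and l: "0 < l"
  defines "g \<equiv> \<lambda>t. \<gamma>1 t / (4 * \<gamma> t)" and "g' \<equiv> \<lambda>t. (\<gamma>2 t * \<gamma> t - (\<gamma>1 t)\<^sup>2) / (4 * (\<gamma> t)\<^sup>2)"
  shows "\<exists>\<phi> \<psi>. \<phi> 0 = 0 \<and> \<psi> 0 = 0 \<and>
    (\<forall>t. (\<phi> has_real_derivative l * sqrt (\<gamma> t)) (at t)) \<and>
    (\<forall>t. (\<psi> has_real_derivative k * (sin (\<phi> t))\<^sup>2 - g t - b) (at t)) \<and>
    mode_solution b l
      (\<lambda>t. \<gamma> t + ((g' t + b\<^sup>2 - (k * (sin (\<phi> t))\<^sup>2 - g t)\<^sup>2) / l\<^sup>2 - 2 * k / l * (sqrt (\<gamma> t) * sin (2 * \<phi> t))))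
      (\<lambda>t. sin (\<phi> t) * exp (\<psi> t))
      (\<lambda>t. (l * sqrt (\<gamma> t) * cos (\<phi> t) + (k * (sin (\<phi> t))\<^sup>2 - g t - b) * sin (\<phi> t)) * exp (\<psi> t))"
proof -
  have \<gamma>c: "continuous_on UNIV \<gamma>" "continuous_on UNIV \<gamma>1"
    using \<gamma>' \<gamma>1' by (auto intro!: DERIV_continuous_on intro: has_field_derivative_at_within)
  have ne: "\<gamma> t \<noteq> 0" for t using pos[of t] by simp
  have "continuous_on UNIV (\<lambda>t. l * sqrt (\<gamma> t))" using \<gamma>c by (intro continuous_intros)
  from antiderivative_exists[OF this] obtain \<phi> where
    \<phi>: "\<phi> 0 = 0" "\<And>t. (\<phi> has_real_derivative l * sqrt (\<gamma> t)) (at t)" by blast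
  have \<phi>c: "continuous_on UNIV \<phi>"
    using \<phi> by (auto intro!: DERIV_continuous_on intro: has_field_derivative_at_within)
  have "continuous_on UNIV (\<lambda>t. k * (sin (\<phi> t))\<^sup>2 - g t - b)"
    unfolding g_def using \<gamma>c \<phi>c ne by (intro continuous_intros) auto
  from antiderivative_exists[OF this] obtain \<psi> where
    \<psi>: "\<psi> 0 = 0" "\<And>t. (\<psi> has_real_derivative k * (sin (\<phi> t))\<^sup>2 - g t - b) (at t)" by blast
  have g': "(g has_real_derivative g' t) (at t)" for t
    unfolding g_def g'_def using ne[of t]
    by (auto intro!: derivative_eq_intros \<gamma>' \<gamma>1' simp: field_simps power2_eq_square)
  define Q where "Q t = sqrt (\<gamma> t)" for t
  have Q': "(Q has_real_derivative 2 * g t * Q t) (at t)" for t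
    unfolding g_def Q_def by (rule has_real_derivative_sqrt_comp[OF \<gamma>' pos])
  have \<phi>': "(\<phi> has_real_derivative l * Q t) (at t)" for t
    using \<phi>(2) by (simp add: Q_def)
  define C where "C t = \<gamma> t + ((g' t + b\<^sup>2 - (k * (sin (\<phi> t))\<^sup>2 - g t)\<^sup>2) / l\<^sup>2
    - 2 * k / l * (sqrt (\<gamma> t) * sin (2 * \<phi> t)))" for t
  define u where "u t = sin (\<phi> t) * exp (\<psi> t)" for t
  define z where "z t = k * (sin (\<phi> t))\<^sup>2 - g t - b" for t
  define v where "v t = (l * Q t * cos (\<phi> t) + z t * sin (\<phi> t)) * exp (\<psi> t)" for t
  have u': "(u has_real_derivative v t) (at t)" for t
    unfolding u_def v_def z_def
    by (auto intro!: derivative_eq_intros \<phi>' \<psi> simp: algebra_simps)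
  have z': "(z has_real_derivative 2 * k * sin (\<phi> t) * cos (\<phi> t) * (l * Q t) - g' t) (at t)" for t
    unfolding z_def by (auto intro!: derivative_eq_intros \<phi>' g' simp: algebra_simps)
  have "(v has_real_derivative - 2 * b * v t - C t * l\<^sup>2 * u t) (at t)" for t
  proof -
    define S where "S = sin (\<phi> t)"
    define c where "c = cos (\<phi> t)"
    define q where "q = Q t"
    define y where "y = z t"
    define v1 where "v1 = (l * (2 * g t * q) * c - l * q * S * (l * q)
        + (2 * k * S * c * (l * q) - g' t) * S + y * (c * (l * q))
        + (l * q * c + y * S) * y) * exp (\<psi> t)"
    have \<psi>y: "(\<psi> has_real_derivative y) (at t)" using \<psi>(2)[of t] by (simp add: y_def z_def)
    have 1: "(v has_real_derivative v1) (at t)"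
      unfolding v_def v1_def S_def c_def q_def y_def
      by (auto intro!: derivative_eq_intros \<phi>' z' Q' \<psi>y[unfolded y_def] simp: algebra_simps)
    have gy: "k * S\<^sup>2 - g t = y + b" by (simp add: y_def z_def S_def)
    have gq: "\<gamma> t = q * q" using pos[of t] by (simp add: q_def Q_def)
    have q0: "0 \<le> q" using pos[of t] by (simp add: q_def Q_def)
    have Cl: "C t * l\<^sup>2 = l\<^sup>2 * (q * q) + g' t + b\<^sup>2 - (y + b)\<^sup>2 - 4 * k * l * q * S * c"
      unfolding C_def Q_def[symmetric] S_def[symmetric] c_def[symmetric] q_def[symmetric] sin_double gy gq
      using l q0 by (simp add: field_simps power2_eq_square)
    have gt: "g t = k * S\<^sup>2 - y - b" using gy by simp
    have "v1 = - 2 * b * v t - C t * l\<^sup>2 * u t"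
      unfolding Cl v1_def v_def u_def S_def[symmetric] c_def[symmetric] q_def[symmetric]
        y_def[symmetric] gt
      by (simp add: algebra_simps power2_eq_square)
    then show ?thesis using 1 by simp
  qed
  then have "mode_solution b l C u v"
    unfolding mode_solution_def using u' by (auto intro: has_field_derivative_at_within)
  then show ?thesis
    using \<phi> \<psi> unfolding C_def[abs_def] u_def[abs_def] v_def[abs_def] z_def Q_def
    by (intro exI[of _ \<phi>] exI[of _ \<psi>]) auto
qed

section \<open>Lower bounds for the resonant solution\<close>

text \<open>Near zeros of the sine the velocity takes over, so the growth of the envelope is visible
  at every time. With \<open>A = l\<^sup>2 * S\<^sup>2\<close> and
  \<open>B = \<mu> / 2 * (l\<^sup>2 * c\<^sup>2)\<close> the velocity part is at least
  \<open>B - A\<close>; the total is therefore at least both \<open>A\<close> and \<open>B\<close>,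
  hence at least their mean.\<close>

lemma oscillation_energy_lower_bound:
  fixes S c q y l \<mu> :: real
  assumes "S\<^sup>2 + c\<^sup>2 = 1" "\<bar>y\<bar> \<le> l" "\<mu> \<le> q\<^sup>2" "0 < l"
  shows "min (\<mu> / 2) 1 / 2 * l\<^sup>2 \<le> ((1 + l) * S)\<^sup>2 + (l * q * c + y * S)\<^sup>2"
proof -
  define x where "x = l * q * c"
  define w where "w = y * S"
  have "y\<^sup>2 \<le> l\<^sup>2" using assms by (simp add: abs_le_square_iff[symmetric])
  then have w: "w\<^sup>2 \<le> l\<^sup>2 * S\<^sup>2" by (simp add: w_def power_mult_distrib mult_right_mono)
  have "(l * S)\<^sup>2 \<le> ((1 + l) * S)\<^sup>2"
    using assms unfolding power_mult_distrib by (intro mult_right_mono power_mono) auto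
  then have T: "l\<^sup>2 * S\<^sup>2 \<le> ((1 + l) * S)\<^sup>2" by (simp add: power_mult_distrib)
  have "0 \<le> (x + 2 * w)\<^sup>2 / 2" by simp
  then have xw: "x\<^sup>2 / 2 - w\<^sup>2 \<le> (x + w)\<^sup>2" by (simp add: power2_eq_square algebra_simps)
  have "x\<^sup>2 = q\<^sup>2 * (l\<^sup>2 * c\<^sup>2)" by (simp add: x_def power_mult_distrib)
  then have xq: "\<mu> * (l\<^sup>2 * c\<^sup>2) \<le> x\<^sup>2" using assms by (simp add: mult_right_mono)
  have "min (\<mu> / 2) 1 * l\<^sup>2 = min (\<mu> / 2) 1 * (l\<^sup>2 * S\<^sup>2) + min (\<mu> / 2) 1 * (l\<^sup>2 * c\<^sup>2)"
    using assms(1) by (simp add: distrib_left[symmetric])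
  also have "\<dots> \<le> 1 * (l\<^sup>2 * S\<^sup>2) + \<mu> / 2 * (l\<^sup>2 * c\<^sup>2)"
    by (intro add_mono mult_right_mono) auto
  finally show ?thesis using T xw w xq zero_le_power2[of "x + w"]
    unfolding x_def[symmetric] w_def[symmetric] by linarith
qed

text \<open>The mean 1/2 of the squared sine gives \<open>k * t / 2\<close>. Its oscillating part
  turns at a speed of order \<open>l\<close>, so by \<open>k \<le> l\<close> its integral costs at
  most a constant times \<open>1 + t\<close>. The essential point is that this constant depends on
  neither \<open>k\<close> nor \<open>l\<close>.\<close>

lemma resonant_exponent_lower_bound:
  fixes \<gamma> \<gamma>1 \<phi> \<psi> :: "real \<Rightarrow> real"
  assumes \<gamma>': "\<And>t. (\<gamma> has_real_derivative \<gamma>1 t) (at t)" and \<mu>: "0 < \<mu>" "\<And>t. \<mu> \<le> \<gamma> t"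
    and G: "\<And>t. \<bar>\<gamma>1 t / (4 * \<gamma> t)\<bar> \<le> G" and l: "0 < l" and k: "0 \<le> k" "k \<le> l"
    and \<phi>: "\<phi> 0 = 0" "\<And>t. (\<phi> has_real_derivative l * sqrt (\<gamma> t)) (at t)"
    and \<psi>: "\<psi> 0 = 0"
      "\<And>t. (\<psi> has_real_derivative k * (sin (\<phi> t))\<^sup>2 - \<gamma>1 t / (4 * \<gamma> t) - b) (at t)"
    and t: "0 \<le> t"
  shows "k * t / 2 - b * t - (G + G / sqrt \<mu> + 1 / sqrt \<mu>) * (1 + t) \<le> \<psi> t"
proof -
  define g where "g t = \<gamma>1 t / (4 * \<gamma> t)" for t
  define C where "C = G + G / sqrt \<mu>"
  have pos: "0 < \<gamma> t" for t using \<mu>(1) \<mu>(2)[of t] by linarith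
  have G0: "0 \<le> G" using G[of 0] by linarith
  have sp: "0 < sqrt \<mu>" and sq: "sqrt \<mu> \<le> sqrt (\<gamma> t)" for t using \<mu> by auto
  have kl: "k / l \<le> 1" "0 \<le> k / l" using k l by auto
  define W where "W t = sin (2 * \<phi> t) / sqrt (\<gamma> t)" for t
  \<comment> \<open>the term with W removes the oscillating part of k sin^2 \<phi>, whose mean is k/2\<close>
  define F where "F t = \<psi> t - k * t / 2 + k / (4 * l) * W t + b * t + C * t" for t
  have inv: "\<bar>x / sqrt (\<gamma> t)\<bar> \<le> B / sqrt \<mu>" if "\<bar>x\<bar> \<le> B" for x B t
  proof -
    have "\<bar>x\<bar> / sqrt (\<gamma> t) \<le> B / sqrt \<mu>" using that sp sq by (intro frac_le) auto
    then show ?thesis using pos[of t] by simp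
  qed
  have "F 0 \<le> F t"
  proof (rule DERIV_nonneg_imp_nondecreasing[OF t])
    fix x assume "0 \<le> x" "x \<le> t"
    have quot: "(c * (2 * (l * q)) * q - s * (2 * r * q)) / (q * q) = 2 * l * c - 2 * (s * r / q)"
      if "q \<noteq> 0" for c q s r :: real
      using that by (simp add: field_simps)
    have ne: "sqrt (\<gamma> x) \<noteq> 0" using pos[of x] by simp
    have sq': "((\<lambda>t. sqrt (\<gamma> t)) has_real_derivative 2 * g x * sqrt (\<gamma> x)) (at x)"
      unfolding g_def by (rule has_real_derivative_sqrt_comp[OF \<gamma>' pos])
    have "((\<lambda>t. sin (2 * \<phi> t) / sqrt (\<gamma> t)) has_real_derivative
       (cos (2 * \<phi> x) * (2 * (l * sqrt (\<gamma> x))) * sqrt (\<gamma> x) - sin (2 * \<phi> x) * (2 * g x * sqrt (\<gamma> x)))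
       / (sqrt (\<gamma> x) * sqrt (\<gamma> x))) (at x)"
      by (intro DERIV_divide sq' ne) (auto intro!: derivative_eq_intros \<phi>)
    also have "(cos (2 * \<phi> x) * (2 * (l * sqrt (\<gamma> x))) * sqrt (\<gamma> x) - sin (2 * \<phi> x) * (2 * g x * sqrt (\<gamma> x)))
       / (sqrt (\<gamma> x) * sqrt (\<gamma> x)) = 2 * l * cos (2 * \<phi> x) - 2 * (sin (2 * \<phi> x) * g x / sqrt (\<gamma> x))"
      using quot[OF ne] .
    finally have W': "(W has_real_derivative
      2 * l * cos (2 * \<phi> x) - 2 * (sin (2 * \<phi> x) * g x / sqrt (\<gamma> x))) (at x)" unfolding W_def[abs_def] .
    have \<psi>x: "(\<psi> has_real_derivative k * (sin (\<phi> x))\<^sup>2 - g x - b) (at x)"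
      using \<psi>(2)[of x] by (simp add: g_def)
    define r where "r = sin (2 * \<phi> x) * g x / sqrt (\<gamma> x)"
    have "(F has_real_derivative (k * (sin (\<phi> x))\<^sup>2 - g x - b) - k / 2
        + k / (4 * l) * (2 * l * cos (2 * \<phi> x) - 2 * r) + b + C) (at x)"
      unfolding F_def using l by (auto intro!: derivative_eq_intros \<psi>x W'[folded r_def])
    also have "(k * (sin (\<phi> x))\<^sup>2 - g x - b) - k / 2
        + k / (4 * l) * (2 * l * cos (2 * \<phi> x) - 2 * r) + b + C
        = C - g x - k / l * (r / 2)"
      unfolding cos_double_sin using l by (simp add: field_simps)
    finally have "(F has_real_derivative C - g x - k / l * (r / 2)) (at x)" .
    moreover have "0 \<le> C - g x - k / l * (r / 2)"
    proof -
      have gG: "\<bar>g x\<bar> \<le> G" using G by (simp add: g_def)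
      have "\<bar>sin (2 * \<phi> x) * g x\<bar> \<le> 1 * G" unfolding abs_mult using gG by (intro mult_mono) auto
      then have r: "\<bar>r\<bar> \<le> G / sqrt \<mu>" unfolding r_def by (intro inv) auto
      have "\<bar>k / l * (r / 2)\<bar> = k / l * \<bar>r / 2\<bar>"
        unfolding abs_mult[of "k / l"] using kl by (simp only: abs_of_nonneg)
      also have "\<dots> \<le> 1 * \<bar>r / 2\<bar>" using kl by (intro mult_right_mono) auto
      finally have "\<bar>k / l * (r / 2)\<bar> \<le> \<bar>r\<bar> / 2" by simp
      then show ?thesis unfolding C_def using r gG by linarith
    qed
    ultimately show "\<exists>y. (F has_real_derivative y) (at x) \<and> 0 \<le> y" by blast
  qed
  moreover have "F 0 = 0" by (simp add: F_def W_def \<phi> \<psi>)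
  moreover have "k / (4 * l) * W t \<le> 1 / sqrt \<mu>"
  proof -
    have "\<bar>W t\<bar> \<le> 1 / sqrt \<mu>" unfolding W_def by (rule inv) auto
    then have "k / (4 * l) * W t \<le> k / (4 * l) * (1 / sqrt \<mu>)"
      using k l by (intro mult_left_mono) auto
    also have "\<dots> \<le> 1 * (1 / sqrt \<mu>)" using k l sp by (intro mult_right_mono) auto
    finally show ?thesis by simp
  qed
  ultimately have "k * t / 2 - b * t - C * t - 1 / sqrt \<mu> \<le> \<psi> t" by (simp add: F_def)
  moreover have "C * t + 1 / sqrt \<mu> \<le> (C + 1 / sqrt \<mu>) * (1 + t)"
  proof -
    have "0 \<le> C" "0 \<le> 1 / sqrt \<mu> * t" using t sp G0 by (auto simp: C_def)
    then show ?thesis unfolding distrib_left distrib_right by linarith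
  qed
  ultimately show ?thesis by (simp add: C_def)
qed

section \<open>Admissibility of the resonant speed at high frequency\<close>

text \<open>The background \<open>\<gamma>\<close> is fixed while \<open>l\<close> tends to
  infinity, so \<open>C\<close> and \<open>D\<close> are independent of \<open>l\<close>. The
  perturbation tends to zero uniformly and its Hoelder constant falls below \<open>H / 2\<close>,
  which is what \<open>holder_perturbation\<close> requires.\<close>

lemma resonant_coefficient:
  fixes \<gamma> \<gamma>1 \<gamma>2 :: "real \<Rightarrow> real"
  assumes \<gamma>': "\<And>t. (\<gamma> has_real_derivative \<gamma>1 t) (at t)" and \<gamma>1': "\<And>t. (\<gamma>1 has_real_derivative \<gamma>2 t) (at t)"
    and hK: "holder \<alpha> K \<gamma>" "K < H" and hL: "holder \<alpha> L \<gamma>2"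
    and L: "\<And>t. \<bar>\<gamma>1 t\<bar> \<le> L" "\<And>t. \<bar>\<gamma>2 t\<bar> \<le> L"
    and mM: "\<And>t. m \<le> \<gamma> t" "\<And>t. \<gamma> t \<le> M" "\<mu>1 < m" "M < \<mu>2"
    and \<mu>1: "0 < \<mu>1" and \<alpha>: "0 < \<alpha>" "\<alpha> < 1" and H: "0 < H" and \<delta>: "0 \<le> \<delta>"
    and \<sigma>: "2 * \<sigma> < 1 - \<alpha>" and e: "0 < e"
  defines "\<kappa> \<equiv> H / (16 * \<mu>2 powr ((1 + \<alpha>) / 2))"
  shows "\<exists>C D. 0 < D \<and> (\<forall>\<^sub>F l in at_top. \<exists>d u v. mode_solution (\<delta> * l powr (2 * \<sigma>)) l d u v \<and>
      holder \<alpha> H d \<and> (\<forall>t. \<bar>d t - \<gamma> t\<bar> \<le> e \<and> \<mu>1 \<le> d t \<and> d t \<le> \<mu>2) \<and>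
      u 0 = 0 \<and> \<bar>v 0\<bar> \<le> l * sqrt \<mu>2 \<and>
      (\<forall>t\<ge>0. D * l * exp (\<kappa> * l powr (1 - \<alpha>) * t / 2 - \<delta> * l powr (2 * \<sigma>) * t - C * (1 + t))
         \<le> cmod (Complex ((1 + l) * u t) (v t))))"
proof -
  have pos: "0 < \<gamma> t" and \<mu>: "\<mu>1 \<le> \<gamma> t" "\<gamma> t \<le> \<mu>2" for t
    using mM(1,2)[of t] mM(3,4) \<mu>1 by auto
  have \<mu>2: "0 < \<mu>2" using pos[of 0] \<mu>(2)[of 0] by linarith
  have \<kappa>: "0 < \<kappa>" using H \<mu>2 by (simp add: \<kappa>_def)
  define g where "g = (\<lambda>t. \<gamma>1 t / (4 * \<gamma> t))"
  define g' where "g' = (\<lambda>t. (\<gamma>2 t * \<gamma> t - (\<gamma>1 t)\<^sup>2) / (4 * (\<gamma> t)\<^sup>2))"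
  have b\<gamma>: "bounded_holder \<alpha> \<gamma>"
    unfolding bounded_holder_def using hK \<mu> pos by (metis abs_of_pos)
  have b\<gamma>1: "bounded_holder \<alpha> \<gamma>1"
    unfolding bounded_holder_def
    using bounded_lipschitz_holder[OF L(1) lipschitz_of_deriv_bound[OF \<gamma>1' L(2)] \<alpha>] L(1) by blast
  have b\<gamma>2: "bounded_holder \<alpha> \<gamma>2" unfolding bounded_holder_def using L(2) hL by blast
  note b\<gamma>i = bounded_holder_inverse[OF hK(1) \<mu>1 \<mu>(1)]
  have "g = (\<lambda>t. (1 / 4) * (\<gamma>1 t * inverse (\<gamma> t)))" by (simp add: g_def field_simps)
  then have "bounded_holder \<alpha> g" using b\<gamma>1 b\<gamma>i by (simp only: bounded_holder_cmult bounded_holder_mult)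
  then obtain G Kg where G: "\<And>t. \<bar>g t\<bar> \<le> G" and Kg: "holder \<alpha> Kg g"
    unfolding bounded_holder_def by blast
  have "g' = (\<lambda>t. (1 / 4) * ((\<gamma>2 t * \<gamma> t - \<gamma>1 t * \<gamma>1 t) * (inverse (\<gamma> t) * inverse (\<gamma> t))))"
    by (simp add: g'_def field_simps power2_eq_square)
  then have "bounded_holder \<alpha> g'" using b\<gamma> b\<gamma>1 b\<gamma>2 b\<gamma>i
    by (simp only: bounded_holder_cmult bounded_holder_mult bounded_holder_diff)
  then obtain G' Kg' where G': "\<And>t. \<bar>g' t\<bar> \<le> G'" and Kg': "holder \<alpha> Kg' g'"
    unfolding bounded_holder_def by blast
  define Kp where "Kp = K / sqrt \<mu>1"
  have Kp: "holder \<alpha> Kp (\<lambda>t. sqrt (\<gamma> t))" unfolding Kp_def by (rule holder_sqrt[OF hK(1) \<mu>1 \<mu>(1)])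
  have G0: "0 \<le> G" using G[of 0] by linarith
  obtain e0 where e0: "0 < e0" and pert: "\<And>p. (\<And>t. \<bar>p t\<bar> \<le> e0) \<Longrightarrow> holder \<alpha> (H / 2) p \<Longrightarrow>
      holder \<alpha> H (\<lambda>t. \<gamma> t + p t)"
    using holder_perturbation[OF hK(1) lipschitz_of_deriv_bound[OF \<gamma>' L(1)] hK(2) H \<alpha>] by blast
  \<comment> \<open>Smallness needed at once for the Hoelder constant (\<open>e0\<close>), for the
    distance to \<open>\<gamma>\<close> (\<open>e\<close>), and for both bounds on the
    speed.\<close>
  define e1 where "e1 = min (min e0 e) (min (m - \<mu>1) (\<mu>2 - M))"
  have e1: "0 < e1" using e0 e mM by (simp add: e1_def)

  define k where "k l = \<kappa> * l powr (1 - \<alpha>)" for l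
  define b where "b l = \<delta> * l powr (2 * \<sigma>)" for l
  define N where "N l = (l * sqrt \<mu>2) powr \<alpha>" for l
  \<comment> \<open>\<open>A l\<close> and \<open>B l\<close> are the Hoelder constant and the sup
    bound that the sum and product rules assign to the perturbation; \<open>N l\<close> is the
    frequency bound raised to the power \<open>\<alpha>\<close>.\<close>
  define A where "A l = 1 / l\<^sup>2 * (Kg' + 0 + ((k l + G) * (k l * (2 * N l) + Kg) + (k l + G) * (k l * (2 * N l) + Kg)))
    + 2 * k l / l * (sqrt \<mu>2 * (2 * N l) + 1 * Kp)" for l
  define B where "B l = 1 / l\<^sup>2 * (G' + (b l)\<^sup>2 + (k l + G)\<^sup>2) + 2 * k l / l * sqrt \<mu>2" for l
  define n where "n = \<mu>2 powr (\<alpha> / 2)"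
  have kl: "k l / l = \<kappa> * l powr (- \<alpha>)" and bl: "b l / l = \<delta> * l powr (2 * \<sigma> - 1)"
    and kN: "k l * N l / l = \<kappa> * n" if "0 < l" for l
  proof -
    show 1: "k l / l = \<kappa> * l powr (- \<alpha>)"
      using that powr_diff[of l "1 - \<alpha>" 1] by (simp add: k_def)
    show "b l / l = \<delta> * l powr (2 * \<sigma> - 1)" using that by (simp add: b_def powr_diff)
    have "N l = l powr \<alpha> * n"
      using that \<mu>2 by (simp add: N_def n_def powr_mult powr_half_sqrt[symmetric] powr_powr)
    then have "k l * N l / l = k l / l * (l powr \<alpha> * n)" by simp
    also have "\<dots> = \<kappa> * n" unfolding 1 using that by (simp add: powr_minus)
    finally show "k l * N l / l = \<kappa> * n" .
  qed
  have lim: "((\<lambda>l. l powr (- \<alpha>)) \<longlongrightarrow> (0::real)) at_top" "((\<lambda>l. l powr (2 * \<sigma> - 1)) \<longlongrightarrow> (0::real)) at_top"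
    "((\<lambda>l. inverse l) \<longlongrightarrow> (0::real)) at_top"
    using \<alpha> \<sigma> by (auto intro!: tendsto_neg_powr filterlim_ident tendsto_inverse_0_at_top)
  \<comment> \<open>The only part of \<open>A l\<close> that survives in the limit: amplitude bound
    \<open>2 * k l / l * sqrt \<mu>2\<close> times the constant \<open>2 * N l\<close> of the sine.
    The 16 in \<open>\<kappa>\<close> makes it \<open>H / 4\<close>, leaving slack below
    \<open>H / 2\<close> for the lower-order terms.\<close>
  have \<kappa>n: "4 * (\<kappa> * n) * sqrt \<mu>2 = H / 4"
  proof -
    have "n * sqrt \<mu>2 = \<mu>2 powr ((1 + \<alpha>) / 2)"
      using \<mu>2 by (simp add: n_def powr_half_sqrt[symmetric] powr_add[symmetric] add_divide_distrib add.commute)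
    then have "4 * (\<kappa> * n) * sqrt \<mu>2 = 4 * \<kappa> * \<mu>2 powr ((1 + \<alpha>) / 2)" by simp
    then show ?thesis using \<mu>2 by (simp add: \<kappa>_def)
  qed
  have "((\<lambda>l. Kg' * (inverse l)\<^sup>2 + 2 * ((\<kappa> * l powr (- \<alpha>) + G * inverse l) * (2 * (\<kappa> * n) + Kg * inverse l))
      + (H / 4 + 2 * (\<kappa> * l powr (- \<alpha>)) * Kp)) \<longlongrightarrow>
      Kg' * 0\<^sup>2 + 2 * ((\<kappa> * 0 + G * 0) * (2 * (\<kappa> * n) + Kg * 0))
      + (H / 4 + 2 * (\<kappa> * 0) * Kp)) at_top"
    by (intro tendsto_intros lim)
  then have "((\<lambda>l. Kg' * (inverse l)\<^sup>2 + 2 * ((\<kappa> * l powr (- \<alpha>) + G * inverse l) * (2 * (\<kappa> * n) + Kg * inverse l))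
      + (H / 4 + 2 * (\<kappa> * l powr (- \<alpha>)) * Kp)) \<longlongrightarrow> H / 4) at_top"
    by simp
  moreover have "\<forall>\<^sub>F l in at_top. Kg' * (inverse l)\<^sup>2 + 2 * ((\<kappa> * l powr (- \<alpha>) + G * inverse l) * (2 * (\<kappa> * n) + Kg * inverse l))
      + (H / 4 + 2 * (\<kappa> * l powr (- \<alpha>)) * Kp) = A l"
    using eventually_gt_at_top[of 0]
  proof eventually_elim
    case (elim l)
    show ?case unfolding A_def \<kappa>n[symmetric] kl[OF elim, symmetric] kN[OF elim, symmetric]
      using elim by (simp add: field_simps power2_eq_square)
  qed
  ultimately have "(A \<longlongrightarrow> H / 4) at_top" by (rule Lim_transform_eventually)
  then have evA: "\<forall>\<^sub>F l in at_top. A l < H / 2" by (rule order_tendstoD) (use H in simp)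
  have "((\<lambda>l. G' * (inverse l)\<^sup>2 + (\<delta> * l powr (2 * \<sigma> - 1))\<^sup>2 + (\<kappa> * l powr (- \<alpha>) + G * inverse l)\<^sup>2
      + 2 * (\<kappa> * l powr (- \<alpha>)) * sqrt \<mu>2) \<longlongrightarrow>
      G' * 0\<^sup>2 + (\<delta> * 0)\<^sup>2 + (\<kappa> * 0 + G * 0)\<^sup>2 + 2 * (\<kappa> * 0) * sqrt \<mu>2) at_top"
    by (intro tendsto_intros lim)
  then have "((\<lambda>l. G' * (inverse l)\<^sup>2 + (\<delta> * l powr (2 * \<sigma> - 1))\<^sup>2 + (\<kappa> * l powr (- \<alpha>) + G * inverse l)\<^sup>2
      + 2 * (\<kappa> * l powr (- \<alpha>)) * sqrt \<mu>2) \<longlongrightarrow> 0) at_top" by simp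
  moreover have "\<forall>\<^sub>F l in at_top. G' * (inverse l)\<^sup>2 + (\<delta> * l powr (2 * \<sigma> - 1))\<^sup>2
      + (\<kappa> * l powr (- \<alpha>) + G * inverse l)\<^sup>2 + 2 * (\<kappa> * l powr (- \<alpha>)) * sqrt \<mu>2 = B l"
    using eventually_gt_at_top[of 0]
  proof eventually_elim
    case (elim l)
    show ?case unfolding B_def kl[OF elim, symmetric] bl[OF elim, symmetric]
      using elim by (simp add: field_simps power2_eq_square)
  qed
  ultimately have "(B \<longlongrightarrow> 0) at_top" by (rule Lim_transform_eventually)
  then have evB: "\<forall>\<^sub>F l in at_top. B l < e1" by (rule order_tendstoD) (use e1 in simp)
  have "((\<lambda>l. \<kappa> * l powr (- \<alpha>) + G * inverse l + \<delta> * l powr (2 * \<sigma> - 1)) \<longlongrightarrow> \<kappa> * 0 + G * 0 + \<delta> * 0) at_top"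
    by (intro tendsto_intros lim)
  then have "\<forall>\<^sub>F l in at_top. \<kappa> * l powr (- \<alpha>) + G * inverse l + \<delta> * l powr (2 * \<sigma> - 1) < 1"
    by (rule order_tendstoD) simp
  \<comment> \<open>Used twice: it bounds \<open>\<psi>'\<close> by \<open>l\<close> in the energy
    estimate and gives \<open>k l \<le> l\<close> for the exponent.\<close>
  then have evk: "\<forall>\<^sub>F l in at_top. k l + G + b l \<le> l"
    using eventually_gt_at_top[of 0]
  proof eventually_elim
    case (elim l)
    from elim(1) have "(k l + G + b l) / l < 1"
      unfolding kl[OF elim(2), symmetric] bl[OF elim(2), symmetric]
      by (simp add: divide_inverse distrib_right)
    then show ?case using elim(2) by simp
  qed

  define D where "D = sqrt (min (\<mu>1 / 2) 1 / 2)"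
  define C where "C = G + G / sqrt \<mu>1 + 1 / sqrt \<mu>1"
  have D: "0 < D" using \<mu>1 by (simp add: D_def)
  have "\<forall>\<^sub>F l in at_top. \<exists>d u v. mode_solution (b l) l d u v \<and>
      holder \<alpha> H d \<and> (\<forall>t. \<bar>d t - \<gamma> t\<bar> \<le> e \<and> \<mu>1 \<le> d t \<and> d t \<le> \<mu>2) \<and>
      u 0 = 0 \<and> \<bar>v 0\<bar> \<le> l * sqrt \<mu>2 \<and>
      (\<forall>t\<ge>0. D * l * exp (k l * t / 2 - b l * t - C * (1 + t))
         \<le> cmod (Complex ((1 + l) * u t) (v t)))"
    using evA evB evk eventually_gt_at_top[of 0]
  proof eventually_elim
    case (elim l)
    note l = elim(4)
    have k0: "0 \<le> k l" and b0: "0 \<le> b l" using \<kappa> \<delta> by (auto simp: k_def b_def)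
    obtain \<phi> \<psi> where \<phi>: "\<phi> 0 = 0" "\<And>t. (\<phi> has_real_derivative l * sqrt (\<gamma> t)) (at t)"
      and \<psi>: "\<psi> 0 = 0" "\<And>t. (\<psi> has_real_derivative k l * (sin (\<phi> t))\<^sup>2 - g t - b l) (at t)"
      and sol: "mode_solution (b l) l
        (\<lambda>t. \<gamma> t + ((g' t + (b l)\<^sup>2 - (k l * (sin (\<phi> t))\<^sup>2 - g t)\<^sup>2) / l\<^sup>2
          - 2 * k l / l * (sqrt (\<gamma> t) * sin (2 * \<phi> t))))
        (\<lambda>t. sin (\<phi> t) * exp (\<psi> t))
        (\<lambda>t. (l * sqrt (\<gamma> t) * cos (\<phi> t) + (k l * (sin (\<phi> t))\<^sup>2 - g t - b l) * sin (\<phi> t)) * exp (\<psi> t))"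
      using resonant_solution[OF \<gamma>' \<gamma>1' pos l, of "k l" "b l"] unfolding g_def g'_def by blast
    define p where "p t = (g' t + (b l)\<^sup>2 - (k l * (sin (\<phi> t))\<^sup>2 - g t)\<^sup>2) / l\<^sup>2
      - 2 * k l / l * (sqrt (\<gamma> t) * sin (2 * \<phi> t))" for t
    define u where "u t = sin (\<phi> t) * exp (\<psi> t)" for t
    define v where "v t = (l * sqrt (\<gamma> t) * cos (\<phi> t)
      + (k l * (sin (\<phi> t))\<^sup>2 - g t - b l) * sin (\<phi> t)) * exp (\<psi> t)" for t
    have sol': "mode_solution (b l) l (\<lambda>t. \<gamma> t + p t) u v"
      using sol by (simp add: p_def[abs_def] u_def[abs_def] v_def[abs_def])
    have \<phi>lip: "\<bar>2 * (l * sqrt (\<gamma> t))\<bar> \<le> 2 * (l * sqrt \<mu>2)" for t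
      using l \<mu>[of t] pos[of t] by (simp add: abs_mult)
    \<comment> \<open>Sup bound 1 and Lipschitz bound \<open>2 * (l * sqrt \<mu>2)\<close> hold both
      for \<open>sin (2 * \<phi> t)\<close> and for the squared sine, so one constant serves
      both.\<close>
    have NN: "(2 * 1) powr (1 - \<alpha>) * (2 * (l * sqrt \<mu>2)) powr \<alpha> = 2 * N l"
      using l \<mu>2 by (simp add: powr_mult N_def powr_add[symmetric] mult.assoc[symmetric])
    have s2: "holder \<alpha> (2 * N l) (\<lambda>t. sin (2 * \<phi> t))"
    proof -
      have 1: "((\<lambda>t. sin (2 * \<phi> t)) has_real_derivative cos (2 * \<phi> t) * (2 * (l * sqrt (\<gamma> t)))) (at t)" for t
        by (auto intro!: derivative_eq_intros \<phi>)
      have 2: "\<bar>cos (2 * \<phi> t) * (2 * (l * sqrt (\<gamma> t)))\<bar> \<le> 2 * (l * sqrt \<mu>2)" for t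
        using mult_mono[OF abs_cos_le_one[of "2 * \<phi> t"] \<phi>lip[of t]] by (simp add: abs_mult)
      show ?thesis
        using bounded_lipschitz_holder[OF _ lipschitz_of_deriv_bound[OF 1 2] \<alpha>, of 1]
        unfolding NN by simp
    qed
    have ss: "holder \<alpha> (2 * N l) (\<lambda>t. (sin (\<phi> t))\<^sup>2)"
    proof -
      have 1: "((\<lambda>t. (sin (\<phi> t))\<^sup>2) has_real_derivative (sin (\<phi> t) * cos (\<phi> t)) * (2 * (l * sqrt (\<gamma> t)))) (at t)" for t
        by (auto intro!: derivative_eq_intros \<phi>)
      have "\<bar>sin (\<phi> t) * cos (\<phi> t)\<bar> \<le> 1" for t
        using mult_mono[OF abs_sin_le_one[of "\<phi> t"] abs_cos_le_one[of "\<phi> t"]] by (simp add: abs_mult)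
      then have 2: "\<bar>(sin (\<phi> t) * cos (\<phi> t)) * (2 * (l * sqrt (\<gamma> t)))\<bar> \<le> 2 * (l * sqrt \<mu>2)" for t
        using mult_mono[OF _ \<phi>lip[of t], of "\<bar>sin (\<phi> t) * cos (\<phi> t)\<bar>" 1] by (simp add: abs_mult)
      have "\<bar>(sin (\<phi> t))\<^sup>2\<bar> \<le> 1" for t by (simp add: abs_square_le_1)
      from bounded_lipschitz_holder[OF this lipschitz_of_deriv_bound[OF 1 2] \<alpha>] show ?thesis
        unfolding NN .
    qed
    define Z where "Z t = k l * (sin (\<phi> t))\<^sup>2 - g t" for t
    have hZ: "holder \<alpha> (k l * (2 * N l) + Kg) Z"
      using holder_diff[OF holder_cmult[OF ss, of "k l"] Kg] k0 by (simp add: Z_def[abs_def])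
    have Zb: "\<bar>Z t\<bar> \<le> k l + G" for t
    proof -
      have "\<bar>k l * (sin (\<phi> t))\<^sup>2\<bar> \<le> k l * 1"
        unfolding abs_mult using k0 by (intro mult_mono) (auto simp: abs_square_le_1)
      then show ?thesis using G[of t] by (simp add: Z_def)
    qed
    have qb: "\<bar>sqrt (\<gamma> t)\<bar> \<le> sqrt \<mu>2" for t using \<mu>[of t] pos[of t] by simp
    have p_eq: "p = (\<lambda>t. 1 / l\<^sup>2 * (g' t + (b l)\<^sup>2 - Z t * Z t) - 2 * k l / l * (sqrt (\<gamma> t) * sin (2 * \<phi> t)))"
      by (simp add: p_def[abs_def] Z_def power2_eq_square)
    have "holder \<alpha> (\<bar>1 / l\<^sup>2\<bar> * (Kg' + 0 + ((k l + G) * (k l * (2 * N l) + Kg) + (k l + G) * (k l * (2 * N l) + Kg)))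
      + \<bar>2 * k l / l\<bar> * (sqrt \<mu>2 * (2 * N l) + 1 * Kp)) p"
      unfolding p_eq
      by (intro holder_diff holder_cmult holder_add Kg' holder_const order_refl
          holder_mult[OF hZ hZ Zb Zb] holder_mult[OF Kp s2 qb]) auto
    moreover have "\<bar>1 / l\<^sup>2\<bar> = 1 / l\<^sup>2" "\<bar>2 * k l / l\<bar> = 2 * k l / l" using l k0 by auto
    ultimately have "holder \<alpha> (A l) p" by (simp only: A_def)
    then have hp: "holder \<alpha> (H / 2) p" by (rule holder_mono) (use elim(1) in simp)
    have pb: "\<bar>p t\<bar> \<le> e1" for t
    proof -
      have "\<bar>Z t * Z t\<bar> \<le> (k l + G)\<^sup>2"
        unfolding abs_mult power2_eq_square using Zb[of t] by (intro mult_mono) auto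
      then have "\<bar>g' t + (b l)\<^sup>2 - Z t * Z t\<bar> \<le> G' + (b l)\<^sup>2 + (k l + G)\<^sup>2"
        using G'[of t] by (smt (verit) zero_le_power2)
      then have 1: "\<bar>1 / l\<^sup>2 * (g' t + (b l)\<^sup>2 - Z t * Z t)\<bar> \<le> 1 / l\<^sup>2 * (G' + (b l)\<^sup>2 + (k l + G)\<^sup>2)"
        unfolding abs_mult by (simp add: divide_right_mono)
      have "\<bar>sqrt (\<gamma> t) * sin (2 * \<phi> t)\<bar> \<le> sqrt \<mu>2 * 1"
        unfolding abs_mult using qb[of t] \<mu>2 by (intro mult_mono) auto
      then have 2: "\<bar>2 * k l / l * (sqrt (\<gamma> t) * sin (2 * \<phi> t))\<bar> \<le> 2 * k l / l * sqrt \<mu>2"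
        using mult_left_mono[of "\<bar>sqrt (\<gamma> t) * sin (2 * \<phi> t)\<bar>" "sqrt \<mu>2" "2 * k l / l"] l k0
        by (simp add: abs_mult)
      have "\<bar>p t\<bar> \<le> B l" unfolding p_eq B_def using 1 2 by linarith
      then show ?thesis using elim(2) by simp
    qed
    have "holder \<alpha> H (\<lambda>t. \<gamma> t + p t)"
    proof (rule pert[OF _ hp])
      show "\<bar>p t\<bar> \<le> e0" for t using pb[of t] by (simp add: e1_def)
    qed
    moreover have "\<bar>(\<gamma> t + p t) - \<gamma> t\<bar> \<le> e \<and> \<mu>1 \<le> \<gamma> t + p t \<and> \<gamma> t + p t \<le> \<mu>2" for t
      using pb[of t] mM(1,2)[of t] by (auto simp: e1_def)
    moreover have "u 0 = 0" by (simp add: u_def \<phi>)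
    moreover have "\<bar>v 0\<bar> \<le> l * sqrt \<mu>2"
      using l qb[of 0] pos[of 0] by (simp add: v_def \<phi> \<psi> abs_mult)
    moreover have "D * l * exp (k l * t / 2 - b l * t - C * (1 + t)) \<le> cmod (Complex ((1 + l) * u t) (v t))"
      if "0 \<le> t" for t
    proof -
      define y where "y = k l * (sin (\<phi> t))\<^sup>2 - g t - b l"
      have y: "\<bar>y\<bar> \<le> l" using Zb[of t] elim(3) b0 by (simp add: y_def Z_def)
      have "k l * t / 2 - b l * t - (G + G / sqrt \<mu>1 + 1 / sqrt \<mu>1) * (1 + t) \<le> \<psi> t"
        by (rule resonant_exponent_lower_bound[OF \<gamma>' \<mu>1 \<mu>(1) G[unfolded g_def] l k0 _ \<phi> \<psi>[unfolded g_def] that])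
          (use elim(3) G0 b0 in linarith)
      then have "D * l * exp (k l * t / 2 - b l * t - C * (1 + t)) \<le> D * l * exp (\<psi> t)"
        using D l by (simp add: C_def)
      also have "\<dots> \<le> cmod (Complex ((1 + l) * u t) (v t))"
      proof -
        have "(D * l * exp (\<psi> t))\<^sup>2 = (min (\<mu>1 / 2) 1 / 2 * l\<^sup>2) * (exp (\<psi> t))\<^sup>2"
          using \<mu>1 by (simp add: D_def power_mult_distrib)
        also have "\<dots> \<le> (((1 + l) * sin (\<phi> t))\<^sup>2 + (l * sqrt (\<gamma> t) * cos (\<phi> t) + y * sin (\<phi> t))\<^sup>2) * (exp (\<psi> t))\<^sup>2"
          by (intro mult_right_mono oscillation_energy_lower_bound)
            (use y l \<mu>[of t] pos[of t] in auto)
        also have "\<dots> = ((1 + l) * u t)\<^sup>2 + (v t)\<^sup>2"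
          unfolding u_def v_def y_def[symmetric]
          by (simp add: distrib_right power_mult_distrib[symmetric] mult.assoc)
        finally show ?thesis by (simp add: cmod_def real_le_rsqrt)
      qed
      finally show ?thesis .
    qed
    ultimately show ?case using sol' by blast
  qed
  then show ?thesis using D unfolding k_def b_def by blast
qed

section \<open>Genericity of growing modes\<close>

lemma PS_udist_upper:
  assumes "c \<in> PS \<mu>1 \<mu>2 \<alpha> H" "d \<in> PS \<mu>1 \<mu>2 \<alpha> H" "0 \<le> t"
  shows "\<bar>c t - d t\<bar> \<le> udist c d"
  unfolding udist_def
proof (rule cSUP_upper)
  show "bdd_above ((\<lambda>t. \<bar>c t - d t\<bar>) ` {0..})"
  proof (rule bdd_aboveI2)
    fix x :: real assume "x \<in> {0..}"
    then have "\<mu>1 \<le> c x" "c x \<le> \<mu>2" "\<mu>1 \<le> d x" "d x \<le> \<mu>2" using assms by (auto simp: PS_def)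
    then show "\<bar>c x - d x\<bar> \<le> \<mu>2 - \<mu>1" by linarith
  qed
qed (use assms in auto)

lemma udist_least:
  assumes "\<And>t. 0 \<le> t \<Longrightarrow> \<bar>c t - d t\<bar> \<le> e"
  shows "udist c d \<le> e"
  unfolding udist_def by (rule cSUP_least) (use assms in auto)

lemma PS_continuous:
  assumes c: "c \<in> PS \<mu>1 \<mu>2 \<alpha> H" and "0 < \<alpha>"
  shows "continuous_on {0..} c"
  unfolding continuous_on_def
proof
  fix s :: real assume s: "s \<in> {0..}"
  have "((\<lambda>t. H * \<bar>t - s\<bar> powr \<alpha>) \<longlongrightarrow> H * \<bar>s - s\<bar> powr \<alpha>) (at s within {0..})"
    using assms(2) by (intro tendsto_intros tendsto_powr') auto
  then have "((\<lambda>t. H * \<bar>t - s\<bar> powr \<alpha>) \<longlongrightarrow> 0) (at s within {0..})" by simp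
  then have "((\<lambda>t. c t - c s) \<longlongrightarrow> 0) (at s within {0..})"
    by (rule Lim_null_comparison[rotated])
      (use c s in \<open>auto simp: PS_def eventually_at_filter\<close>)
  then show "(c \<longlongrightarrow> c s) (at s within {0..})" by (simp add: Lim_null[of c "c s"])
qed

text \<open>The modulus packs the weights for \<open>\<beta>\<close> equal to 1/2 and 0, namely the
  square of \<open>1 + lam i\<close> for \<open>u\<close> and 1 for \<open>v\<close>. The threshold,
  squared, is the reciprocal of the weight of the logarithmic space, so such a mode contributes more
  than 1 to the series there, while \<open>(1/2) ^ n\<close> keeps the initial series summable. A
  compact window with a strict inequality is what makes the condition open.\<close>

definition growing_mode ::
  "(nat \<Rightarrow> real) \<Rightarrow> real \<Rightarrow> real \<Rightarrow> real \<Rightarrow> real \<Rightarrow> real \<Rightarrow> nat \<Rightarrow> (real \<Rightarrow> real) \<Rightarrow> nat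
    \<Rightarrow> (real \<Rightarrow> real) \<Rightarrow> (real \<Rightarrow> real) \<Rightarrow> bool" where
  "growing_mode lam \<alpha> \<delta> \<sigma> r0 t0 n c i u v \<longleftrightarrow>
     mode_solution (\<delta> * Apow_eig lam \<sigma> i) (lam i) c u v \<and>
     cmod (Complex ((1 + lam i) * u 0) (v 0)) \<le> (1/2) ^ n * exp (- r0 * lam i powr (1 - \<alpha>)) \<and>
     (\<forall>t\<in>{t0 + 1 / real (Suc n)..real (Suc n)}.
        exp (lam i powr (1 - \<alpha>) / ln (2 + lam i)) < cmod (Complex ((1 + lam i) * u t) (v t)))"

definition growing_speeds ::
  "(nat \<Rightarrow> real) \<Rightarrow> real \<Rightarrow> real \<Rightarrow> real \<Rightarrow> real \<Rightarrow> real \<Rightarrow> (real \<Rightarrow> real) set \<Rightarrow> nat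
    \<Rightarrow> (real \<Rightarrow> real) set" where
  "growing_speeds lam \<alpha> \<delta> \<sigma> r0 t0 X n =
     {c \<in> X. \<exists>i\<ge>n. \<exists>u v. growing_mode lam \<alpha> \<delta> \<sigma> r0 t0 n c i u v}"

text \<open>The same index and the same initial data are kept for nearby speeds. On the compact
  window the strict inequality has a margin \<open>\<eta>\<close>, and stability moves the mode by
  at most half of it.\<close>

lemma growing_speeds_open:
  assumes "0 < \<mu>1" "0 < \<alpha>" "0 \<le> \<delta>" and t0: "0 \<le> t0" and lam: "\<And>i. 0 \<le> lam i"
  shows "open_in_space (PS \<mu>1 \<mu>2 \<alpha> H) (growing_speeds lam \<alpha> \<delta> \<sigma> r0 t0 (PS \<mu>1 \<mu>2 \<alpha> H) n)"
    (is "open_in_space ?X ?U")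
  unfolding open_in_space_def
proof (intro conjI ballI)
  show "?U \<subseteq> ?X" by (auto simp: growing_speeds_def)
next
  fix c assume "c \<in> ?U"
  then obtain i u v where c: "c \<in> ?X" and i: "n \<le> i" and gm: "growing_mode lam \<alpha> \<delta> \<sigma> r0 t0 n c i u v"
    by (auto simp: growing_speeds_def)
  define l where "l = lam i"
  define b where "b = \<delta> * Apow_eig lam \<sigma> i"
  define E where "E = exp (l powr (1 - \<alpha>) / ln (2 + l))"
  define I where "I = {t0 + 1 / real (Suc n)..real (Suc n)}"
  define T where "T = real (Suc n)"
  have l: "0 \<le> l" using lam by (simp add: l_def)
  have b: "0 \<le> b" using \<open>0 \<le> \<delta>\<close> by (simp add: b_def Apow_eig_def)
  have sol: "mode_solution b l c u v"
    and big: "\<And>t. t \<in> I \<Longrightarrow> E < cmod (Complex ((1 + l) * u t) (v t))"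
    and init: "cmod (Complex ((1 + l) * u 0) (v 0)) \<le> (1/2) ^ n * exp (- r0 * l powr (1 - \<alpha>))"
    using gm by (auto simp: growing_mode_def l_def b_def E_def I_def)
  have I0: "I \<subseteq> {0..T}"
    using t0 by (auto simp: I_def T_def intro: order_trans[OF add_nonneg_nonneg])
  note cont = mode_solution_continuous[OF sol]
  \<comment> \<open>The window is empty when \<open>n\<close> is small compared with
    \<open>t0\<close>; any margin then works.\<close>
  have "\<exists>\<eta>>0. \<forall>t\<in>I. E + \<eta> \<le> cmod (Complex ((1 + l) * u t) (v t))"
  proof (cases "I = {}")
    case True then show ?thesis by (intro exI[of _ 1]) auto
  next
    case False
    have "continuous_on I u" "continuous_on I v"
      using cont I0 by (auto elim!: continuous_on_subset)
    then have "continuous_on I (\<lambda>t. cmod (Complex ((1 + l) * u t) (v t)))"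
      unfolding cmod_def by (auto intro!: continuous_intros)
    moreover have "compact I" by (simp add: I_def)
    ultimately obtain t where t: "t \<in> I"
      "\<And>s. s \<in> I \<Longrightarrow> cmod (Complex ((1 + l) * u t) (v t)) \<le> cmod (Complex ((1 + l) * u s) (v s))"
      using continuous_attains_inf[of I] False by blast
    then show ?thesis using big[OF t(1)]
      by (intro exI[of _ "cmod (Complex ((1 + l) * u t) (v t)) - E"]) auto
  qed
  then obtain \<eta> where \<eta>: "0 < \<eta>" "\<And>t. t \<in> I \<Longrightarrow> E + \<eta> \<le> cmod (Complex ((1 + l) * u t) (v t))"
    by blast
  have "compact (u ` {0..T})"
    using cont by (intro compact_continuous_image) (auto elim!: continuous_on_subset)
  then obtain B where "\<forall>x\<in>{0..T}. \<bar>u x\<bar> \<le> B"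
    using compact_imp_bounded[of "u ` {0..T}"] by (auto simp: bounded_iff)
  then have B: "\<bar>u t\<bar> \<le> B" if "0 \<le> t" "t \<le> T" for t using that by simp
  \<comment> \<open>Stability bounds the squared weighted distance by
    \<open>e\<^sup>2 * (R - 1)\<close>, and \<open>e\<close> is chosen so that
    \<open>e\<^sup>2 * R\<close> is the square of \<open>\<eta> / 2\<close>; the added 1 keeps
    \<open>R\<close> positive.\<close>
  define R where "R = (l\<^sup>2 * B)\<^sup>2 * exp ((2 + \<mu>2 * l\<^sup>2) * T) * (1 + l)\<^sup>2 + 1"
  have R: "0 < R" by (simp add: R_def add_nonneg_pos)
  define e where "e = \<eta> / (2 * sqrt R)"
  have e: "0 < e" using \<eta> R by (simp add: e_def)
  have "d \<in> ?U" if d: "d \<in> ?X" and cd: "udist c d < e" for d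
  proof -
    have db: "\<bar>d t\<bar> \<le> \<mu>2" if "0 \<le> t" for t
      using d that \<open>0 < \<mu>1\<close> by (force simp: PS_def abs_le_iff)
    obtain u' v' where sol': "mode_solution b l d u' v'" and 0: "u' 0 = u 0" "v' 0 = v 0"
      using mode_solution_exists[OF PS_continuous[OF d \<open>0 < \<alpha>\<close>] db] by blast
    have cde: "\<bar>c t - d t\<bar> \<le> e" if "0 \<le> t" for t
      using PS_udist_upper[OF c d that] cd by linarith
    have "E < cmod (Complex ((1 + l) * u' t) (v' t))" if t: "t \<in> I" for t
    proof -
      have t': "0 \<le> t" "t \<le> T" using t I0 by auto
      define x where "x = u t - u' t"
      define y where "y = v t - v' t"
      have st: "x\<^sup>2 + y\<^sup>2 \<le> (e * l\<^sup>2 * B)\<^sup>2 * exp ((2 + \<mu>2 * l\<^sup>2) * T)"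
        unfolding x_def y_def by (rule mode_solution_stability[OF sol sol' b 0 db cde B t'])
      have "((1 + l) * x)\<^sup>2 + y\<^sup>2 \<le> (1 + l)\<^sup>2 * (x\<^sup>2 + y\<^sup>2)"
        using l mult_right_mono[of 1 "(1 + l)\<^sup>2" "y\<^sup>2"] by (simp add: power_mult_distrib distrib_left)
      also have "\<dots> \<le> (1 + l)\<^sup>2 * ((e * l\<^sup>2 * B)\<^sup>2 * exp ((2 + \<mu>2 * l\<^sup>2) * T))"
        using st by (intro mult_left_mono) auto
      also have "\<dots> = e\<^sup>2 * (R - 1)" by (simp add: R_def power_mult_distrib mult_ac)
      also have "\<dots> \<le> e\<^sup>2 * R" by (intro mult_left_mono) auto
      also have "\<dots> = (\<eta> / 2)\<^sup>2" using R by (simp add: e_def power_divide power_mult_distrib)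
      finally have "cmod (Complex ((1 + l) * x) y) \<le> \<eta> / 2"
        unfolding cmod_def complex.sel by (rule real_le_lsqrt[rotated]) (use \<eta>(1) in simp)
      moreover have "Complex ((1 + l) * u t) (v t) = Complex ((1 + l) * x) y + Complex ((1 + l) * u' t) (v' t)"
        by (simp add: x_def y_def complex_eq_iff algebra_simps)
      then have "cmod (Complex ((1 + l) * u t) (v t))
          \<le> cmod (Complex ((1 + l) * x) y) + cmod (Complex ((1 + l) * u' t) (v' t))"
        by (metis norm_triangle_ineq)
      ultimately show ?thesis using \<eta>(1) \<eta>(2)[OF t] by linarith
    qed
    then have "growing_mode lam \<alpha> \<delta> \<sigma> r0 t0 n d i u' v'"
      using sol' init by (simp add: growing_mode_def l_def b_def E_def I_def 0)
    then show ?thesis using d i by (auto simp: growing_speeds_def)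
  qed
  then show "\<exists>\<epsilon>>0. \<forall>d\<in>?X. udist c d < \<epsilon> \<longrightarrow> d \<in> ?U" using e by blast
qed

section \<open>Density: the growth exponent against its losses\<close>

text \<open>After division by \<open>l powr (1 - \<alpha>)\<close> every loss tends to zero: the
  demanded growth thanks to the logarithm, the damping thanks to
  \<open>2 * \<sigma> < 1 - \<alpha>\<close>, and the constant because
  \<open>\<alpha> < 1\<close>.\<close>

lemma eventually_resonance_beats_log_loss:
  fixes \<alpha> \<sigma> q C p :: real
  assumes "\<alpha> < 1" "2 * \<sigma> < 1 - \<alpha>" "0 < q"
  shows "\<forall>\<^sub>F l in at_top. l powr (1 - \<alpha>) / ln (2 + l) < q * l powr (1 - \<alpha>) - p * l powr (2 * \<sigma>) - C"
proof -
  have "filterlim (\<lambda>l. ln (2 + l)) at_top (at_top :: real filter)"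
    by (intro filterlim_compose[OF ln_at_top] filterlim_tendsto_add_at_top[OF tendsto_const] filterlim_ident)
  then have "((\<lambda>l. inverse (ln (2 + l))) \<longlongrightarrow> (0::real)) at_top"
    by (rule tendsto_inverse_0_at_top)
  moreover have "((\<lambda>l. l powr (2 * \<sigma> - (1 - \<alpha>))) \<longlongrightarrow> (0::real)) at_top"
    "((\<lambda>l. l powr (- (1 - \<alpha>))) \<longlongrightarrow> (0::real)) at_top"
    using assms by (auto intro!: tendsto_neg_powr filterlim_ident)
  ultimately have "((\<lambda>l. inverse (ln (2 + l)) + p * l powr (2 * \<sigma> - (1 - \<alpha>)) + C * l powr (- (1 - \<alpha>)))
      \<longlongrightarrow> 0 + p * 0 + C * 0) at_top"
    by (intro tendsto_intros)
  then have "\<forall>\<^sub>F l in at_top. inverse (ln (2 + l)) + p * l powr (2 * \<sigma> - (1 - \<alpha>)) + C * l powr (- (1 - \<alpha>)) < q"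
    by (rule order_tendstoD) (use assms in simp)
  then show ?thesis using eventually_gt_at_top[of 0]
  proof eventually_elim
    case (elim l)
    define w where "w = l powr (1 - \<alpha>)"
    have w: "0 < w" using elim by (simp add: w_def)
    have "l powr (2 * \<sigma> - (1 - \<alpha>)) = l powr (2 * \<sigma>) / w" "l powr (- (1 - \<alpha>)) = 1 / w"
      using elim by (simp_all add: w_def powr_diff powr_minus_divide del: minus_diff_eq)
    then have "w * (inverse (ln (2 + l)) + p * (l powr (2 * \<sigma>) / w) + C * (1 / w)) < w * q"
      using elim(1) w by simp
    moreover have "w * (inverse (ln (2 + l)) + p * (l powr (2 * \<sigma>) / w) + C * (1 / w))
        = w / ln (2 + l) + p * l powr (2 * \<sigma>) + C"
      using w by (simp add: distrib_left divide_inverse[of w])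
    ultimately show ?case unfolding w_def[symmetric] by (simp add: mult.commute)
  qed
qed

lemma growing_speeds_dense:
  assumes lam: "unbounded_discrete_mult_op lam"
    and \<mu>: "0 < \<mu>1" "\<mu>1 < \<mu>2" and \<alpha>: "0 < \<alpha>" "\<alpha> < 1" and H: "0 < H" and \<delta>: "0 \<le> \<delta>" "0 \<le> \<sigma>"
    and \<sigma>: "2 * \<sigma> < 1 - \<alpha>" and r0: "0 < r0"
  defines "t0 \<equiv> 32 * \<mu>2 powr ((1 + \<alpha>) / 2) / H * r0"
  shows "dense_in_space (PS \<mu>1 \<mu>2 \<alpha> H) (growing_speeds lam \<alpha> \<delta> \<sigma> r0 t0 (PS \<mu>1 \<mu>2 \<alpha> H) n)"
    (is "dense_in_space ?X ?U")
  unfolding dense_in_space_def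
proof (intro conjI ballI allI impI)
  show "?U \<subseteq> ?X" by (auto simp: growing_speeds_def)
next
  fix c \<epsilon> assume c: "c \<in> ?X" and \<epsilon>: "(0::real) < \<epsilon>"
  have \<epsilon>3: "0 < \<epsilon> / 3" using \<epsilon> by simp
  obtain \<gamma> \<gamma>1 \<gamma>2 K L m M where
    \<gamma>': "\<And>t. (\<gamma> has_real_derivative \<gamma>1 t) (at t)" "\<And>t. (\<gamma>1 has_real_derivative \<gamma>2 t) (at t)"
    and hK: "holder \<alpha> K \<gamma>" "K < H" "holder \<alpha> L \<gamma>2"
    and L: "\<And>t. \<bar>\<gamma>1 t\<bar> \<le> L" "\<And>t. \<bar>\<gamma>2 t\<bar> \<le> L"
    and mM: "\<And>t. m \<le> \<gamma> t" "\<And>t. \<gamma> t \<le> M" "\<mu>1 < m" "M < \<mu>2"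
    and near: "\<And>t. 0 \<le> t \<Longrightarrow> \<bar>\<gamma> t - c t\<bar> \<le> \<epsilon> / 3"
    using smooth_approximation[OF c \<mu> \<alpha>(1) H \<epsilon>3] by metis
  define \<kappa> where "\<kappa> = H / (16 * \<mu>2 powr ((1 + \<alpha>) / 2))"
  have \<kappa>: "0 < \<kappa>" using H \<mu> by (simp add: \<kappa>_def)
  \<comment> \<open>Growth at rate \<open>\<kappa> / 2\<close> recovers the initial factor
    \<open>exp (- r0 * w)\<close> exactly at \<open>t0\<close>; this fixes 32 as twice the 16 in
    \<open>\<kappa>\<close>.\<close>
  have \<kappa>t0: "\<kappa> / 2 * t0 = r0" using H \<mu> by (simp add: \<kappa>_def t0_def)
  obtain C0 D where D: "0 < D" and ev: "\<forall>\<^sub>F l in at_top. \<exists>d u v. mode_solution (\<delta> * l powr (2 * \<sigma>)) l d u v \<and>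
      holder \<alpha> H d \<and> (\<forall>t. \<bar>d t - \<gamma> t\<bar> \<le> \<epsilon> / 3 \<and> \<mu>1 \<le> d t \<and> d t \<le> \<mu>2) \<and>
      u 0 = 0 \<and> \<bar>v 0\<bar> \<le> l * sqrt \<mu>2 \<and>
      (\<forall>t\<ge>0. D * l * exp (\<kappa> * l powr (1 - \<alpha>) * t / 2 - \<delta> * l powr (2 * \<sigma>) * t - C0 * (1 + t))
         \<le> cmod (Complex ((1 + l) * u t) (v t)))"
    using resonant_coefficient[OF \<gamma>' hK L mM \<mu>(1) \<alpha> H \<delta>(1) \<sigma> \<epsilon>3] unfolding \<kappa>_def by blast
  define T where "T = real (Suc n)"
  \<comment> \<open>The exponent, in units of \<open>l powr (1 - \<alpha>)\<close>, gained during
    the delay \<open>1 / T\<close> after \<open>t0\<close>.\<close>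
  define q where "q = \<kappa> / (2 * T)"
  have T: "0 < T" by (simp add: T_def)
  have q: "0 < q" using \<kappa> T by (simp add: q_def)
  \<comment> \<open>Collects what does not depend on the mode: the correction
    \<open>C0 * (1 + t)\<close> over the window and the logarithm of the prefactor left after
    normalising the initial data.\<close>
  define C where "C = \<bar>C0\<bar> * (1 + T) - ln ((1/2) ^ n * D / sqrt \<mu>2)"
  have "\<forall>\<^sub>F l in at_top. l powr (1 - \<alpha>) / ln (2 + l) < q * l powr (1 - \<alpha>) - (\<delta> * T) * l powr (2 * \<sigma>) - C"
    by (rule eventually_resonance_beats_log_loss[OF \<alpha>(2) \<sigma> q])
  note ev' = eventually_conj[OF ev eventually_conj[OF this eventually_gt_at_top[of 0]]]
  have "filterlim lam at_top sequentially" using lam by (simp add: unbounded_discrete_mult_op_def)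
  from eventually_conj[OF eventually_compose_filterlim[OF ev' this] eventually_ge_at_top[of n]]
  obtain i where i: "n \<le> i" and l0: "0 < lam i" and
    beat: "lam i powr (1 - \<alpha>) / ln (2 + lam i) < q * lam i powr (1 - \<alpha>) - (\<delta> * T) * lam i powr (2 * \<sigma>) - C" and
    ex: "\<exists>d u v. mode_solution (\<delta> * lam i powr (2 * \<sigma>)) (lam i) d u v \<and>
      holder \<alpha> H d \<and> (\<forall>t. \<bar>d t - \<gamma> t\<bar> \<le> \<epsilon> / 3 \<and> \<mu>1 \<le> d t \<and> d t \<le> \<mu>2) \<and>
      u 0 = 0 \<and> \<bar>v 0\<bar> \<le> lam i * sqrt \<mu>2 \<and>
      (\<forall>t\<ge>0. D * lam i * exp (\<kappa> * lam i powr (1 - \<alpha>) * t / 2 - \<delta> * lam i powr (2 * \<sigma>) * t - C0 * (1 + t))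
         \<le> cmod (Complex ((1 + lam i) * u t) (v t)))"
    by (auto dest!: eventually_happens)
  define l where "l = lam i"
  define w where "w = l powr (1 - \<alpha>)"
  define b where "b = \<delta> * l powr (2 * \<sigma>)"
  have l: "0 < l" using l0 by (simp add: l_def)
  \<comment> \<open>\<open>l > 0\<close> reconciles \<open>l powr (2 * \<sigma>)\<close> with the
    convention of \<open>Apow_eig\<close> when \<open>\<sigma> = 0\<close>.\<close>
  have b: "b = \<delta> * Apow_eig lam \<sigma> i" "0 \<le> b"
    using l \<delta> by (auto simp: b_def Apow_eig_def l_def)
  obtain d u v where sol: "mode_solution b l d u v" and hd: "holder \<alpha> H d"
    and dg: "\<And>t. \<bar>d t - \<gamma> t\<bar> \<le> \<epsilon> / 3" and d\<mu>: "\<And>t. \<mu>1 \<le> d t" "\<And>t. d t \<le> \<mu>2"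
    and u0: "u 0 = 0" and v0: "\<bar>v 0\<bar> \<le> l * sqrt \<mu>2"
    and grow: "\<And>t. 0 \<le> t \<Longrightarrow> D * l * exp (\<kappa> * w * t / 2 - b * t - C0 * (1 + t))
         \<le> cmod (Complex ((1 + l) * u t) (v t))"
    using ex unfolding l_def[symmetric] b_def[symmetric] w_def[symmetric] by blast
  \<comment> \<open>The normalisation on the negative axis demanded by \<open>PS\<close>; the mode
    equation only sees \<open>t \<ge> 0\<close>.\<close>
  define d' where "d' t = (if t < 0 then 0 else d t)" for t
  have d'X: "d' \<in> ?X"
    using hd d\<mu> by (auto simp: PS_def d'_def holder_def)
  have "udist c d' \<le> 2 * (\<epsilon> / 3)"
  proof (rule udist_least)
    fix t :: real assume t: "0 \<le> t"
    have "\<bar>c t - d t\<bar> \<le> 2 * (\<epsilon> / 3)" using near[OF t] dg[of t] by linarith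
    then show "\<bar>c t - d' t\<bar> \<le> 2 * (\<epsilon> / 3)" using t by (simp add: d'_def)
  qed
  then have dist: "udist c d' < \<epsilon>" using \<epsilon> by simp
  \<comment> \<open>Linearity allows rescaling: since \<open>u 0 = 0\<close> and
    \<open>\<bar>v 0\<bar> \<le> l * sqrt \<mu>2\<close>, this factor enforces the initial bound.
    Its \<open>1 / l\<close> cancels against the \<open>l\<close> in the growth estimate.\<close>
  define a where "a = (1/2) ^ n * exp (- r0 * w) / (l * sqrt \<mu>2)"
  have a: "0 < a" using l \<mu> by (simp add: a_def)
  have scale: "cmod (Complex ((1 + l) * (a * u t)) (a * v t)) = a * cmod (Complex ((1 + l) * u t) (v t))" for t
  proof -
    have "Complex ((1 + l) * (a * u t)) (a * v t) = of_real a * Complex ((1 + l) * u t) (v t)"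
      by (simp add: complex_eq_iff)
    then show ?thesis using a by (simp add: norm_mult)
  qed
  have "mode_solution b l d' (\<lambda>t. a * u t) (\<lambda>t. a * v t)"
    using sol unfolding mode_solution_def d'_def
    by (auto intro!: derivative_eq_intros simp: algebra_simps)
  moreover have "cmod (Complex ((1 + l) * (a * u 0)) (a * v 0)) \<le> (1/2) ^ n * exp (- r0 * w)"
  proof -
    have "cmod (Complex ((1 + l) * u 0) (v 0)) = \<bar>v 0\<bar>" by (simp add: u0 cmod_def)
    then have "cmod (Complex ((1 + l) * (a * u 0)) (a * v 0)) \<le> a * (l * sqrt \<mu>2)"
      unfolding scale using v0 a by simp
    also have "\<dots> = (1/2) ^ n * exp (- r0 * w)" using l \<mu> by (simp add: a_def)
    finally show ?thesis .
  qed
  moreover have "exp (w / ln (2 + l)) < cmod (Complex ((1 + l) * (a * u t)) (a * v t))"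
    if t: "t \<in> {t0 + 1 / real (Suc n)..real (Suc n)}" for t
  proof -
    have t0: "0 < t0" using H \<mu> r0 by (simp add: t0_def)
    have tt: "t0 + 1 / T \<le> t" "t \<le> T" using t by (auto simp: T_def)
    have tpos: "0 \<le> t" using tt t0 T by (smt (verit) divide_nonneg_nonneg)
    have w: "0 < w" using l by (simp add: w_def)
    have "\<kappa> / 2 * (t0 + 1 / T) \<le> \<kappa> / 2 * t" using tt \<kappa> by (intro mult_left_mono) auto
    then have "r0 + q \<le> \<kappa> / 2 * t" using \<kappa>t0 by (simp add: distrib_left q_def)
    then have 1: "w * (r0 + q) \<le> w * (\<kappa> / 2 * t)" using w by (intro mult_left_mono) auto
    have 2: "b * t \<le> b * T" using tt b by (intro mult_left_mono) auto
    have "C0 * (1 + t) \<le> \<bar>C0\<bar> * (1 + t)" using tpos by (intro mult_right_mono) auto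
    also have "\<dots> \<le> \<bar>C0\<bar> * (1 + T)" using tt by (intro mult_left_mono) auto
    finally have 3: "C0 * (1 + t) \<le> \<bar>C0\<bar> * (1 + T)" .
    have 4: "w / ln (2 + l) < q * w - b * T - C"
      using beat by (simp add: l_def w_def b_def mult_ac)
    define s where "s = (1/2) ^ n * D / sqrt \<mu>2"
    have s: "0 < s" using D \<mu> by (simp add: s_def)
    have 5: "w / ln (2 + l) < ln s + (- r0 * w + (\<kappa> * w * t / 2 - b * t - C0 * (1 + t)))"
      using 1 2 3 4 unfolding C_def s_def[symmetric] by (simp add: algebra_simps)
    have "exp (w / ln (2 + l)) < exp (ln s + (- r0 * w + (\<kappa> * w * t / 2 - b * t - C0 * (1 + t))))"
      using 5 by simp
    also have "\<dots> = s * (exp (- r0 * w) * exp (\<kappa> * w * t / 2 - b * t - C0 * (1 + t)))"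
      unfolding exp_add using s by simp
    also have "\<dots> = a * (D * l * exp (\<kappa> * w * t / 2 - b * t - C0 * (1 + t)))"
      using l \<mu> by (simp add: a_def s_def)
    also have "\<dots> \<le> a * cmod (Complex ((1 + l) * u t) (v t))"
      using grow[OF tpos] a by (intro mult_left_mono) auto
    finally show ?thesis by (simp only: scale)
  qed
  ultimately have "growing_mode lam \<alpha> \<delta> \<sigma> r0 t0 n d' i (\<lambda>t. a * u t) (\<lambda>t. a * v t)"
    unfolding growing_mode_def b(1)[symmetric] l_def[symmetric] w_def[symmetric] by blast
  then show "\<exists>d\<in>?U. udist c d < \<epsilon>"
    using d'X dist i by (intro bexI[of _ d']) (auto simp: growing_speeds_def)
qed

section \<open>Superposition of growing modes\<close>

lemma very_weak_solution_of_modes: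
  assumes c: "c \<in> PS \<mu>1 \<mu>2 \<alpha> H" "0 < \<alpha>"
    and sol: "\<And>i. mode_solution (\<delta> * Apow_eig lam \<sigma> i) (lam i) c (u i) (v i)"
  shows "very_weak_solution lam \<delta> \<sigma> c u v"
  unfolding very_weak_solution_def
proof
  fix i
  define w where "w t = - 2 * (\<delta> * Apow_eig lam \<sigma> i) * v i t - c t * (lam i)\<^sup>2 * u i t" for t
  have "continuous_on {0..} w"
    unfolding w_def by (intro continuous_intros PS_continuous[OF c] mode_solution_continuous[OF sol])
  moreover have "(u i has_real_derivative v i t) (at t within {0..}) \<and>
      (v i has_real_derivative w t) (at t within {0..}) \<and>
      w t + 2 * \<delta> * Apow_eig lam \<sigma> i * v i t + c t * (lam i)\<^sup>2 * u i t = 0" if "0 \<le> t" for t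
    using sol[of i] that unfolding mode_solution_def w_def by auto
  ultimately show "\<exists>w. continuous_on {0..} w \<and>
        (\<forall>t\<ge>0. (u i has_real_derivative v i t) (at t within {0..})
              \<and> (v i has_real_derivative w t) (at t within {0..})
              \<and> w t + 2 * \<delta> * Apow_eig lam \<sigma> i * v i t + c t * (lam i)\<^sup>2 * u i t = 0)"
    by blast
qed

text \<open>Growing modes of increasing levels are placed at distinct indices and all other
  components are zero. A fixed \<open>t > t0\<close> lies in the windows of all sufficiently high
  levels, so the combined series at time \<open>t\<close> has infinitely many terms above 1.\<close>

lemma rapidly_growing_solution:
  assumes lam: "\<And>i. 0 \<le> lam i" and c: "c \<in> PS \<mu>1 \<mu>2 \<alpha> H" and \<alpha>: "0 < \<alpha>" "\<alpha> < 1"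
    and s: "s = 1 / (1 - \<alpha>)"
    and U: "\<And>n. \<exists>i\<ge>n. \<exists>u v. growing_mode lam \<alpha> \<delta> \<sigma> r0 t0 n c i u v"
  shows "\<exists>u v. very_weak_solution lam \<delta> \<sigma> c u v
              \<and> (\<lambda>i. u i 0) \<in> gevrey_space lam s r0 (1/2)
              \<and> (\<lambda>i. v i 0) \<in> gevrey_space lam s r0 0
              \<and> (\<forall>t > t0. \<not> ((\<lambda>i. u i t) \<in> ultradist_log_space lam s (1/2)
                      \<and> (\<lambda>i. v i t) \<in> ultradist_log_space lam s 0))"
proof -
  have s1: "1 / s = 1 - \<alpha>" using \<alpha> by (simp add: s)
  obtain ix p q where ix: "\<And>n. n \<le> ix n" and gm: "\<And>n. growing_mode lam \<alpha> \<delta> \<sigma> r0 t0 n c (ix n) (p n) (q n)"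
    using U by metis
  \<comment> \<open>The next level exceeds the index just used; as \<open>ix n \<ge> n\<close>, the
    chosen indices strictly increase and no component is assigned twice.\<close>
  define N where "N = rec_nat 0 (\<lambda>_ m. Suc (ix m))"
  have N: "N (Suc k) = Suc (ix (N k))" for k by (simp add: N_def)
  have "N k < N (Suc k)" for k using ix[of "N k"] by (simp add: N)
  then have Nmono: "strict_mono N" by (rule strict_mono_Suc_iff[THEN iffD2, OF allI])
  define j where "j k = ix (N k)" for k
  have "j k < j (Suc k)" for k using ix[of "N (Suc k)"] by (simp add: j_def N)
  then have jmono: "strict_mono j" by (rule strict_mono_Suc_iff[THEN iffD2, OF allI])
  then have inj: "inj j" by (rule strict_mono_imp_inj_on)
  define u where "u i = (if i \<in> range j then p (N (inv j i)) else (\<lambda>_. 0))" for i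
  define v where "v i = (if i \<in> range j then q (N (inv j i)) else (\<lambda>_. 0))" for i
  have uj: "u (j k) = p (N k)" "v (j k) = q (N k)" for k using inj by (auto simp: u_def v_def)
  have uz: "u i = (\<lambda>_. 0)" "v i = (\<lambda>_. 0)" if "i \<notin> range j" for i using that by (auto simp: u_def v_def)
  have gmj: "growing_mode lam \<alpha> \<delta> \<sigma> r0 t0 (N k) c (j k) (u (j k)) (v (j k))" for k
    unfolding uj using gm[of "N k"] by (simp add: j_def)
  have sol: "mode_solution (\<delta> * Apow_eig lam \<sigma> i) (lam i) c (u i) (v i)" for i
  proof (cases "i \<in> range j")
    case True then show ?thesis using gmj by (auto simp: growing_mode_def)
  next
    case False then show ?thesis by (simp add: uz mode_solution_def)
  qed
  have Nk: "k \<le> N k" for k using Nmono by (rule strict_mono_imp_increasing)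
  have w2: "(1 + lam i) powr (4 * (1/2)) = (1 + lam i)\<^sup>2" "(1 + lam i) powr (4 * 0) = 1" for i
    using lam[of i] powr_realpow[of "1 + lam i" 2] by auto
  define Y where "Y k = cmod (Complex ((1 + lam (j k)) * u (j k) 0) (v (j k) 0))" for k
  have Y: "(Y k)\<^sup>2 * exp (2 * r0 * lam (j k) powr (1 - \<alpha>)) \<le> (1/2) ^ k" for k
  proof -
    have "Y k \<le> (1/2) ^ N k * exp (- r0 * lam (j k) powr (1 - \<alpha>))"
      using gmj[of k] by (simp add: growing_mode_def Y_def)
    also have "\<dots> \<le> (1/2) ^ k * exp (- r0 * lam (j k) powr (1 - \<alpha>))"
      using Nk[of k] by (intro mult_right_mono power_decreasing) auto
    finally have "(Y k)\<^sup>2 \<le> ((1/2) ^ k * exp (- r0 * lam (j k) powr (1 - \<alpha>)))\<^sup>2"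
      by (rule power_mono) (simp add: Y_def)
    then have "(Y k)\<^sup>2 * exp (2 * r0 * lam (j k) powr (1 - \<alpha>))
        \<le> ((1/2) ^ k * exp (- r0 * lam (j k) powr (1 - \<alpha>)))\<^sup>2 * exp (2 * r0 * lam (j k) powr (1 - \<alpha>))"
      by (rule mult_right_mono) simp
    also have "\<dots> = ((1/2) ^ k)\<^sup>2"
      by (simp add: power_mult_distrib exp_double[symmetric] exp_add[symmetric])
    also have "\<dots> \<le> (1/2) ^ k"
      unfolding power_mult[symmetric] by (intro power_decreasing) auto
    finally show ?thesis .
  qed
  \<comment> \<open>Each of the two Gevrey series is dominated by their sum, whose terms at the
    chosen indices are at most \<open>(1/2) ^ k\<close>; \<open>jmono\<close> transfers summability
    from the subsequence to all indices.\<close>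
  have sumI: "summable f" if z: "\<And>i. i \<notin> range j \<Longrightarrow> f i = 0" and nn: "\<And>i. 0 \<le> f i"
    and le: "\<And>k. f (j k) \<le> (Y k)\<^sup>2 * exp (2 * r0 * lam (j k) powr (1 - \<alpha>))" for f :: "nat \<Rightarrow> real"
  proof -
    have "summable (\<lambda>k. f (j k))"
    proof (rule summable_comparison_test')
      show "summable (\<lambda>k. (1/2 :: real) ^ k)" by (intro summable_geometric) auto
      show "norm (f (j k)) \<le> (1/2) ^ k" for k using le[of k] Y[of k] nn[of "j k"] by simp
    qed
    then show ?thesis using summable_mono_reindex[OF jmono, of f] z by blast
  qed
  have Ysq: "(Y k)\<^sup>2 = (u (j k) 0)\<^sup>2 * (1 + lam (j k))\<^sup>2 + (v (j k) 0)\<^sup>2" for k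
    by (simp add: Y_def cmod_power2 power_mult_distrib mult.commute)
  have "(\<lambda>i. u i 0) \<in> gevrey_space lam s r0 (1/2)"
    unfolding gevrey_space_def mem_Collect_eq w2 s1
    by (rule sumI) (auto simp: uz Ysq)
  moreover have "(\<lambda>i. v i 0) \<in> gevrey_space lam s r0 0"
    unfolding gevrey_space_def mem_Collect_eq w2 s1
    by (rule sumI) (auto simp: uz Ysq)
  moreover have "\<not> ((\<lambda>i. u i t) \<in> ultradist_log_space lam s (1/2) \<and>
      (\<lambda>i. v i t) \<in> ultradist_log_space lam s 0)" if t: "t0 < t" for t
  proof
    \<comment> \<open>The sum of the two series is used because growth is known only for the
      combined modulus; position and velocity may alternate in carrying it.\<close>
    define f where "f i = ((u i t)\<^sup>2 * (1 + lam i)\<^sup>2 + (v i t)\<^sup>2)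
        * exp (- (2 * lam i powr (1 - \<alpha>)) / ln (2 + lam i))" for i
    assume "(\<lambda>i. u i t) \<in> ultradist_log_space lam s (1/2) \<and> (\<lambda>i. v i t) \<in> ultradist_log_space lam s 0"
    then have "summable f"
      unfolding ultradist_log_space_def mem_Collect_eq w2 s1 f_def
      by (auto dest: summable_add simp: distrib_right)
    then have "(\<lambda>k. f (j k)) \<longlonglongrightarrow> 0"
      using LIMSEQ_subseq_LIMSEQ[OF summable_LIMSEQ_zero jmono] by (simp add: o_def)
    then have "\<forall>\<^sub>F k in sequentially. f (j k) < 1" by (rule order_tendstoD) simp
    \<comment> \<open>Since \<open>N k \<ge> k\<close>, from \<open>k0\<close> on the window starts
      before \<open>t\<close> and ends after it.\<close>
    moreover obtain k0 where k0: "t \<le> real k0" "1 / (t - t0) \<le> real k0"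
      using real_arch_simple[of "max t (1 / (t - t0))"] by auto
    moreover have "1 < f (j k)" if "k0 \<le> k" for k
    proof -
      have kN: "real k0 \<le> real (Suc (N k))" using that Nk[of k] by simp
      then have "1 / (t - t0) \<le> real (Suc (N k))" using k0 by linarith
      then have "1 / real (Suc (N k)) \<le> t - t0" using t by (simp add: field_simps)
      then have "t \<in> {t0 + 1 / real (Suc (N k))..real (Suc (N k))}" using k0 kN by auto
      then have "exp (lam (j k) powr (1 - \<alpha>) / ln (2 + lam (j k)))
          < cmod (Complex ((1 + lam (j k)) * u (j k) t) (v (j k) t))"
        using gmj[of k] by (auto simp: growing_mode_def)
      then have "(exp (lam (j k) powr (1 - \<alpha>) / ln (2 + lam (j k))))\<^sup>2
          < (cmod (Complex ((1 + lam (j k)) * u (j k) t) (v (j k) t)))\<^sup>2"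
        by (rule power_strict_mono) auto
      also have "\<dots> = (u (j k) t)\<^sup>2 * (1 + lam (j k))\<^sup>2 + (v (j k) t)\<^sup>2"
        by (simp add: cmod_power2 power_mult_distrib mult.commute)
      finally have "exp (2 * (lam (j k) powr (1 - \<alpha>) / ln (2 + lam (j k))))
          < (u (j k) t)\<^sup>2 * (1 + lam (j k))\<^sup>2 + (v (j k) t)\<^sup>2"
        by (simp only: exp_double)
      then show ?thesis by (simp add: f_def exp_minus field_simps)
    qed
    ultimately show False
      by (metis (no_types, lifting) eventually_sequentially linorder_le_cases order_less_asym)
  qed
  ultimately show ?thesis
    using very_weak_solution_of_modes[OF c \<alpha>(1) sol] by blast
qed

theorem mainTheorem1:
  fixes lam :: "nat \<Rightarrow> real" and \<mu>1 \<mu>2 \<alpha> H \<delta> \<sigma> s S r0 :: real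
  assumes "unbounded_discrete_mult_op lam"
    and "0 < \<mu>1" and "\<mu>1 < \<mu>2" and "0 < \<alpha>" and "\<alpha> < 1" and "0 < H"
    and "\<delta> \<ge> 0" and "\<sigma> \<ge> 0" and "2 * \<sigma> < 1 - \<alpha>"
    and "s = 1 / (1 - \<alpha>)" and "S = 1 / (1 - \<alpha>)" and "r0 > 0"
  shows "residual_in_space (PS \<mu>1 \<mu>2 \<alpha> H)
           {c \<in> PS \<mu>1 \<mu>2 \<alpha> H. \<exists>u v. very_weak_solution lam \<delta> \<sigma> c u v
              \<and> (\<lambda>i. u i 0) \<in> gevrey_space lam s r0 (1/2)
              \<and> (\<lambda>i. v i 0) \<in> gevrey_space lam s r0 0
              \<and> (\<forall>t > 32 * \<mu>2 powr ((1 + \<alpha>) / 2) / H * r0.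
                   \<not> ((\<lambda>i. u i t) \<in> ultradist_log_space lam S (1/2)
                      \<and> (\<lambda>i. v i t) \<in> ultradist_log_space lam S 0))}"
proof -
  define t0 where "t0 = 32 * \<mu>2 powr ((1 + \<alpha>) / 2) / H * r0"
  define X where "X = PS \<mu>1 \<mu>2 \<alpha> H"
  define U where "U = growing_speeds lam \<alpha> \<delta> \<sigma> r0 t0 X"
  have lam: "0 \<le> lam i" for i using assms(1) by (simp add: unbounded_discrete_mult_op_def)
  have t0: "0 \<le> t0" using assms by (simp add: t0_def)
  have "open_in_space X (U n) \<and> dense_in_space X (U n)" for n
    unfolding U_def X_def
    using growing_speeds_open[OF assms(2,4,7) t0 lam]
      growing_speeds_dense[OF assms(1-9,12)] by (simp add: t0_def)
  moreover have "X \<inter> (\<Inter>n. U n) \<subseteq> {c \<in> X. \<exists>u v. very_weak_solution lam \<delta> \<sigma> c u v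
              \<and> (\<lambda>i. u i 0) \<in> gevrey_space lam s r0 (1/2)
              \<and> (\<lambda>i. v i 0) \<in> gevrey_space lam s r0 0
              \<and> (\<forall>t > t0. \<not> ((\<lambda>i. u i t) \<in> ultradist_log_space lam S (1/2)
                      \<and> (\<lambda>i. v i t) \<in> ultradist_log_space lam S 0))}"
  proof
    fix c assume c: "c \<in> X \<inter> (\<Inter>n. U n)"
    then have cX: "c \<in> PS \<mu>1 \<mu>2 \<alpha> H" by (simp add: X_def)
    have gr: "\<exists>i\<ge>n. \<exists>u v. growing_mode lam \<alpha> \<delta> \<sigma> r0 t0 n c i u v" for n
      using c by (auto simp: U_def growing_speeds_def)
    have sS: "S = s" using assms by simp
    show "c \<in> {c \<in> X. \<exists>u v. very_weak_solution lam \<delta> \<sigma> c u v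
              \<and> (\<lambda>i. u i 0) \<in> gevrey_space lam s r0 (1/2)
              \<and> (\<lambda>i. v i 0) \<in> gevrey_space lam s r0 0
              \<and> (\<forall>t > t0. \<not> ((\<lambda>i. u i t) \<in> ultradist_log_space lam S (1/2)
                      \<and> (\<lambda>i. v i t) \<in> ultradist_log_space lam S 0))}"
      using rapidly_growing_solution[OF lam cX assms(4,5,10) gr] c unfolding sS by blast
  qed
  ultimately show ?thesis
    unfolding residual_in_space_def X_def[symmetric] t0_def[symmetric] by blast
qed

end
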